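(* The cohomology of $d$ computed in $H(\gamma)$ is trivial in form degree strictly less than $D$ and in strictly positive antighost number: $$H^{g,k}_p\big(d,H(\gamma)\big)=0,\qquad k>0,\; p<D,$$ where $p$ is the form degree, $k$ the antighost number and $g$ the ghost number. Explicitly: if $a$ is a local form with $\deg(a)=p<D$, $\mathrm{agh}(a)=k>0$, $\mathrm{gh}(a)=g$, satisfying $\gamma a=0$ and $da=\gamma\mu$ for some local form $\mu$, then there exist local forms $\nu,\rho$ with $$a=d\nu+\gamma\rho,\qquad \gamma\nu=0,$$ where $\mathrm{agh}(\nu)=\mathrm{agh}(\rho)=k$, $\mathrm{gh}(\nu)=g$, $\mathrm{gh}(\rho)=g-1$, $\deg(\nu)=p-1$, $\deg(\rho)=p$.
   Context: Conventions. Fix $D\ge 5$ and flat $\mathbb{R}^D$ with Minkowski metric $\sigma=\mathrm{diag}(-,+,\dots,+)$. $[\mu\nu\cdots]$ denotes antisymmetrization without normalization factors and with the minimal number of terms, e.g. $\partial_{[\mu}C_{\nu]\alpha}=\partial_\mu C_{\nu\alpha}-\partial_\nu C_{\mu\alpha}$, $t_{[\mu\nu|\alpha]\beta}=t_{\mu\nu|\alpha\beta}+t_{\nu\alpha|\mu\beta}+t_{\alpha\mu|\nu\beta}$. Generators. The field $t_{\mu\nu|\alpha\beta}$ (commuting) is antisymmetric in $\mu\nu$ and in $\alpha\beta$, symmetric under exchange of the two pairs, and $t_{[\mu\nu|\alpha]\beta}=0$. Ghosts: $\eta_{\mu\nu|\alpha}$ (anticommuting), antisymmetric in $\mu\nu$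 with $\eta_{[\mu\nu|\alpha]}=0$; $C_{\mu\nu}=-C_{\nu\mu}$ (commuting). Antifields $\chi^{*\Delta}=(t^{*\mu\nu|\alpha\beta},\eta^{*\mu\nu|\alpha},C^{*\mu\nu})$ have the same index symmetries as $t,\eta,C$ respectively and opposite Grassmann parity (odd, even, odd). Apart from these symmetries, all components and all their derivatives (symmetric in derivative indices) are independent jet variables. Local forms are polynomials with constant coefficients in these variables and the $dx^\mu$ (no explicit $x$-dependence); a local form of negative form degree is zero. $d=dx^\mu\partial_\mu$ with $\partial_\mu$ the total derivative; $\deg$ is the form degree. Gradings. Pure ghost number pgh: $t:0$, $\eta:1$, $C:2$, antifields: $0$. Antighost number agh: $t,\eta,C:0$; $t^*:1$, $\eta^*:2$, $C^*:3$. Ghost number $\mathrm{gh}=\mathrm{pgh}-\mathrm{agh}$. Derivatives and $dx^\mu$ do not change these gradings. Differential. $\gamma$ is the nilpotent (right) derivation commuting with $\partial_\mu$, with signs such that $\gamma d+d\gamma=0$, given by $\gamma t_{\mu\nu|\alpha\beta}=\partial_\mu\eta_{\alpha\beta|\nu}-\partial_\nu\eta_{\alpha\beta|\mu}+\partial_\alpha\eta_{\mu\nu|\beta}-\partial_\beta\eta_{\mu\nu|\alpha}$, $\gamma\eta_{\mu\nu|\alpha}=2\partial_\alpha C_{\mu\nu}-\partial_{[\mu}C_{\nu]\alpha}$, $\gamma C_{\mu\nu}=0$, $\gamma\chi^{*\Delta}=0$. $H(\gamma)$ is its cohomology in the algebra of local forms. *)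

theory Defs
  imports Complex_Main "HOL-Library.Cardinality" "HOL-Library.Poly_Mapping" "HOL-Library.Multiset"
begin

section \<open>Jet variables\<close>

text \<open>
  The type \<open>'n\<close> is the set of values of a space-time index, so that \<open>D = CARD('n)\<close>.
  The metric is only used to place the antifield indices upstairs; neither \<open>\<gamma>\<close> nor \<open>d\<close>
  contracts indices with it, hence antifield components are labelled by plain indices too.
  The components are those of \<open>t\<close>, \<open>\<eta>\<close>, \<open>C\<close> and of the antifields \<open>t\<^sup>*\<close>, \<open>\<eta>\<^sup>*\<close>, \<open>C\<^sup>*\<close>.
\<close>

datatype 'n component =
    Tfield 'n 'n 'n 'n | Eta 'n 'n 'n | Cghost 'n 'n
  | Tst 'n 'n 'n 'n | Etast 'n 'n 'n | Cst 'n 'n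

text \<open>
  \<open>Jet {#\<rho>, \<sigma>, \<dots>#} \<Phi>\<close> stands for the jet variable \<open>\<partial>\<^sub>\<rho> \<partial>\<^sub>\<sigma> \<dots> \<Phi>\<close>; using a multiset makes derivative
  indices symmetric. The index symmetries of the components are imposed by the relations below.
\<close>

datatype 'n gen = Dx 'n | Jet "'n multiset" "'n component"

fun comp_grassmann :: "'n component \<Rightarrow> nat" where
  "comp_grassmann (Tfield _ _ _ _) = 0"
| "comp_grassmann (Eta _ _ _) = 1"
| "comp_grassmann (Cghost _ _) = 0"
| "comp_grassmann (Tst _ _ _ _) = 1"
| "comp_grassmann (Etast _ _ _) = 0"
| "comp_grassmann (Cst _ _) = 1"

fun comp_pgh :: "'n component \<Rightarrow> nat" where
  "comp_pgh (Eta _ _ _) = 1"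
| "comp_pgh (Cghost _ _) = 2"
| "comp_pgh _ = 0"

fun comp_agh :: "'n component \<Rightarrow> nat" where
  "comp_agh (Tst _ _ _ _) = 1"
| "comp_agh (Etast _ _ _) = 2"
| "comp_agh (Cst _ _) = 3"
| "comp_agh _ = 0"

fun on_jet :: "('n component \<Rightarrow> nat) \<Rightarrow> 'n gen \<Rightarrow> nat" where
  "on_jet f (Dx _) = 0"
| "on_jet f (Jet _ \<Phi>) = f \<Phi>"

abbreviation "grassmann \<equiv> on_jet comp_grassmann"
abbreviation "pgh \<equiv> on_jet comp_pgh"
abbreviation "agh \<equiv> on_jet comp_agh"

definition gh :: "'n gen \<Rightarrow> int" where
  "gh x = int (pgh x) - int (agh x)"

fun form_deg :: "'n gen \<Rightarrow> nat" where
  "form_deg (Dx _) = 1"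
| "form_deg (Jet _ _) = 0"

text \<open>
  Sign convention: the commutation signs are governed by the total parity, so the \<open>dx\<^sup>\<mu>\<close>
  anticommute with each other and with the Grassmann-odd jet variables.
\<close>

definition parity :: "'n gen \<Rightarrow> nat" where
  "parity x = form_deg x + grassmann x"


section \<open>The free associative algebra on the jet variables and the differentials\<close>

text \<open>Words form a monoid (written additively) under concatenation; finitely supported
  functions on words then form the free associative real algebra.\<close>

datatype 'g word = Word (letters: "'g list")

instantiation word :: (type) monoid_add
begin
definition "0 = Word []"
definition "u + v = Word (letters u @ letters v)"
instance by standard (simp_all add: zero_word_def plus_word_def)
end

type_synonym 'n free = "'n gen word \<Rightarrow>\<^sub>0 real"

definition mon :: "'n gen list \<Rightarrow> 'n free" where
  "mon xs = Poly_Mapping.single (Word xs) 1"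

abbreviation gen :: "'n gen \<Rightarrow> 'n free" where
  "gen x \<equiv> mon [x]"

definition word_deg :: "('n gen \<Rightarrow> 'a::monoid_add) \<Rightarrow> 'n gen word \<Rightarrow> 'a" where
  "word_deg f w = (\<Sum>x\<leftarrow>letters w. f x)"

definition lin_ext :: "('n gen list \<Rightarrow> 'n free) \<Rightarrow> 'n free \<Rightarrow> 'n free" where
  "lin_ext f p = (\<Sum>w\<in>Poly_Mapping.keys p.
     Poly_Mapping.single 0 (Poly_Mapping.lookup p w) * f (letters w))"

text \<open>
  The (twisted) derivation with values \<open>\<delta>\<close> on generators, picking up the sign \<open>(-1)^l x\<close> for
  every generator \<open>x\<close> standing to the left of the one acted upon and \<open>(-1)^r x\<close> for every
  generator \<open>x\<close> standing to the right of it.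
\<close>

fun deriv_word ::
    "('n gen \<Rightarrow> nat) \<Rightarrow> ('n gen \<Rightarrow> nat) \<Rightarrow> ('n gen \<Rightarrow> 'n free) \<Rightarrow> 'n gen list \<Rightarrow> 'n free" where
  "deriv_word l r \<delta> [] = 0"
| "deriv_word l r \<delta> (x # xs) =
     (-1) ^ l x * gen x * deriv_word l r \<delta> xs + (-1) ^ (\<Sum>y\<leftarrow>xs. r y) * \<delta> x * mon xs"

definition deriv_free ::
    "('n gen \<Rightarrow> nat) \<Rightarrow> ('n gen \<Rightarrow> nat) \<Rightarrow> ('n gen \<Rightarrow> 'n free) \<Rightarrow> 'n free \<Rightarrow> 'n free" where
  "deriv_free l r \<delta> = lin_ext (deriv_word l r \<delta>)"

fun partial_gen :: "'n \<Rightarrow> 'n gen \<Rightarrow> 'n free" where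
  "partial_gen \<mu> (Dx \<nu>) = 0"
| "partial_gen \<mu> (Jet m \<Phi>) = gen (Jet (add_mset \<mu> m) \<Phi>)"

definition partial_free :: "'n \<Rightarrow> 'n free \<Rightarrow> 'n free" where
  "partial_free \<mu> = deriv_free (\<lambda>_. 0) (\<lambda>_. 0) (partial_gen \<mu>)"

text \<open>The values of \<open>\<gamma>\<close> on derivatives of \<open>t\<close> and \<open>\<eta>\<close> are forced by \<open>\<gamma> \<partial>\<^sub>\<mu> = \<partial>\<^sub>\<mu> \<gamma>\<close>.\<close>

fun gamma_gen :: "'n gen \<Rightarrow> 'n free" where
  "gamma_gen (Jet m (Tfield \<mu> \<nu> \<alpha> \<beta>)) =
       gen (Jet (add_mset \<mu> m) (Eta \<alpha> \<beta> \<nu>)) - gen (Jet (add_mset \<nu> m) (Eta \<alpha> \<beta> \<mu>))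
     + gen (Jet (add_mset \<alpha> m) (Eta \<mu> \<nu> \<beta>)) - gen (Jet (add_mset \<beta> m) (Eta \<mu> \<nu> \<alpha>))"
| "gamma_gen (Jet m (Eta \<mu> \<nu> \<alpha>)) =
       2 * gen (Jet (add_mset \<alpha> m) (Cghost \<mu> \<nu>))
     - (gen (Jet (add_mset \<mu> m) (Cghost \<nu> \<alpha>)) - gen (Jet (add_mset \<nu> m) (Cghost \<mu> \<alpha>)))"
| "gamma_gen _ = 0"

text \<open>
  \<open>\<gamma>\<close> is a right derivation with respect to the Grassmann parity of the jet variables, and
  additionally anticommutes with every \<open>dx\<^sup>\<mu>\<close> standing on the left. Equivalently, \<open>\<gamma>\<close> is
  \<open>(-1)\<close> to the form degree times the right derivation for the total parity. This is what
  makes \<open>\<gamma> d + d \<gamma> = 0\<close> hold for \<open>d = dx\<^sup>\<mu> \<partial>\<^sub>\<mu>\<close>.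
\<close>

definition gamma_free :: "'n free \<Rightarrow> 'n free" where
  "gamma_free = deriv_free form_deg grassmann gamma_gen"


section \<open>Relations\<close>

text \<open>
  Local forms are the free algebra modulo graded commutativity (which for an odd generator
  \<open>x\<close> gives \<open>2 * x * x = 0\<close>) and the index symmetries of the fields, ghosts and antifields
  together with all derivatives of these symmetries.
\<close>

inductive_set relations :: "'n free set" where
  super_comm: "gen x * gen y - (-1) ^ (parity x * parity y) * gen y * gen x \<in> relations"
| riem_antisym1: "\<Phi> \<in> {Tfield, Tst} \<Longrightarrow> gen (Jet m (\<Phi> \<mu> \<nu> \<alpha> \<beta>)) + gen (Jet m (\<Phi> \<nu> \<mu> \<alpha> \<beta>)) \<in> relations"
| riem_antisym2: "\<Phi> \<in> {Tfield, Tst} \<Longrightarrow> gen (Jet m (\<Phi> \<mu> \<nu> \<alpha> \<beta>)) + gen (Jet m (\<Phi> \<mu> \<nu> \<beta> \<alpha>)) \<in> relations"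
| riem_pair: "\<Phi> \<in> {Tfield, Tst} \<Longrightarrow> gen (Jet m (\<Phi> \<mu> \<nu> \<alpha> \<beta>)) - gen (Jet m (\<Phi> \<alpha> \<beta> \<mu> \<nu>)) \<in> relations"
| riem_cyclic: "\<Phi> \<in> {Tfield, Tst} \<Longrightarrow>
    gen (Jet m (\<Phi> \<mu> \<nu> \<alpha> \<beta>)) + gen (Jet m (\<Phi> \<nu> \<alpha> \<mu> \<beta>)) + gen (Jet m (\<Phi> \<alpha> \<mu> \<nu> \<beta>)) \<in> relations"
| hook_antisym: "\<Phi> \<in> {Eta, Etast} \<Longrightarrow> gen (Jet m (\<Phi> \<mu> \<nu> \<alpha>)) + gen (Jet m (\<Phi> \<nu> \<mu> \<alpha>)) \<in> relations"
| hook_cyclic: "\<Phi> \<in> {Eta, Etast} \<Longrightarrow>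
    gen (Jet m (\<Phi> \<mu> \<nu> \<alpha>)) + gen (Jet m (\<Phi> \<nu> \<alpha> \<mu>)) + gen (Jet m (\<Phi> \<alpha> \<mu> \<nu>)) \<in> relations"
| two_antisym: "\<Phi> \<in> {Cghost, Cst} \<Longrightarrow> gen (Jet m (\<Phi> \<mu> \<nu>)) + gen (Jet m (\<Phi> \<nu> \<mu>)) \<in> relations"

inductive_set rel_ideal :: "'n free set" where
  zero: "0 \<in> rel_ideal"
| add: "p \<in> rel_ideal \<Longrightarrow> q \<in> rel_ideal \<Longrightarrow> p + q \<in> rel_ideal"
| rel: "q \<in> relations \<Longrightarrow> p * q * r \<in> rel_ideal"


section \<open>Auxiliary facts about derivations of the free algebra\<close>

lemma rel_ideal_mult_left: "q \<in> rel_ideal \<Longrightarrow> p * q \<in> rel_ideal"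
  by (induction rule: rel_ideal.induct)
    (auto simp: distrib_left simp flip: mult.assoc intro: rel_ideal.intros)

lemma rel_ideal_mult_right: "q \<in> rel_ideal \<Longrightarrow> q * p \<in> rel_ideal"
  by (induction rule: rel_ideal.induct)
    (auto simp: distrib_right mult.assoc intro: rel_ideal.intros rel_ideal.rel[unfolded mult.assoc])

lemma rel_ideal_uminus: "q \<in> rel_ideal \<Longrightarrow> - q \<in> rel_ideal"
  using rel_ideal_mult_left[of q "-1"] by simp

lemma rel_ideal_diff: "p \<in> rel_ideal \<Longrightarrow> q \<in> rel_ideal \<Longrightarrow> p - q \<in> rel_ideal"
  using rel_ideal.add[of p "- q"] rel_ideal_uminus[of q] by simp

lemma relations_in_ideal: "q \<in> relations \<Longrightarrow> q \<in> rel_ideal"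
  using rel_ideal.rel[of q 1 1] by simp

lemma free_induct [case_names zero single add]:
  fixes p :: "'a \<Rightarrow>\<^sub>0 real"
  assumes "P 0" "\<And>w c. P (Poly_Mapping.single w c)" "\<And>p q. P p \<Longrightarrow> P q \<Longrightarrow> P (p + q)"
  shows "P p"
proof -
  have "P (\<Sum>w\<in>A. Poly_Mapping.single w (f w))" if "finite A" for A f
    using that by induction (auto intro: assms)
  moreover have "p = (\<Sum>w\<in>Poly_Mapping.keys p. Poly_Mapping.single w (Poly_Mapping.lookup p w))"
    by (rule poly_mapping_eqI)
      (auto simp: lookup_sum lookup_single when_def sum.delta not_in_keys_iff_lookup_eq_zero)
  ultimately show ?thesis by (metis finite_keys)
qed

lemma lin_ext_superset:
  assumes "finite A" "Poly_Mapping.keys p \<subseteq> A"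
  shows "lin_ext f p = (\<Sum>w\<in>A. Poly_Mapping.single 0 (Poly_Mapping.lookup p w) * f (letters w))"
  unfolding lin_ext_def using assms
  by (intro sum.mono_neutral_left) (auto simp: not_in_keys_iff_lookup_eq_zero)

lemma lin_ext_add: "lin_ext f (p + q) = lin_ext f p + lin_ext f q"
proof -
  let ?A = "Poly_Mapping.keys p \<union> Poly_Mapping.keys q"
  have "Poly_Mapping.keys (p + q) \<subseteq> ?A" by (rule Poly_Mapping.keys_add)
  then show ?thesis
    by (simp add: lin_ext_superset[of ?A] lookup_add single_add distrib_right sum.distrib)
qed

lemma lin_ext_zero [simp]: "lin_ext f 0 = 0"
  by (simp add: lin_ext_def)

lemma lin_ext_uminus: "lin_ext f (- p) = - lin_ext f p"
  using lin_ext_add[of f p "- p"] by (simp add: eq_neg_iff_add_eq_0 add.commute)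

lemma lin_ext_diff: "lin_ext f (p - q) = lin_ext f p - lin_ext f q"
  using lin_ext_add[of f p "- q"] by (simp add: lin_ext_uminus)

lemma lin_ext_single: "lin_ext f (Poly_Mapping.single w c) = Poly_Mapping.single 0 c * f (letters w)"
  by (simp add: lin_ext_superset[of "{w}"])

lemma lin_ext_mon [simp]: "lin_ext f (mon xs) = f xs"
  by (simp add: mon_def lin_ext_single)

lemma mon_append: "mon (xs @ ys) = mon xs * mon ys"
  by (simp add: mon_def mult_single plus_word_def)

lemma mon_Nil [simp]: "mon [] = 1"
  by (simp add: mon_def flip: zero_word_def)

lemma mon_Cons: "mon (x # xs) = gen x * mon xs"
  using mon_append[of "[x]" xs] by simp

lemma single_eq_mon: "Poly_Mapping.single w c = Poly_Mapping.single 0 c * mon (letters w)"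
  by (simp add: mon_def mult_single)

lemma scalar_central: "Poly_Mapping.single 0 c * p = p * Poly_Mapping.single 0 c"
  for p :: "'n free"
  by (induction p rule: free_induct) (simp_all add: mult_single distrib_left distrib_right mult.commute)

lemma lin_ext_scalar: "lin_ext f (Poly_Mapping.single 0 c * p) = Poly_Mapping.single 0 c * lin_ext f p"
  by (induction p rule: free_induct)
    (simp_all add: mult_single lin_ext_single lin_ext_add distrib_left flip: mult.assoc)

text \<open>Bilinear identities need only be checked on words.\<close>

lemma bilinear_ext:
  fixes F G :: "'n free \<Rightarrow> 'n free \<Rightarrow> 'n free"
  assumes "\<And>p p' q. F (p + p') q = F p q + F p' q" "\<And>p q q'. F p (q + q') = F p q + F p q'"
    and "\<And>p p' q. G (p + p') q = G p q + G p' q" "\<And>p q q'. G p (q + q') = G p q + G p q'"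
    and "\<And>c p q. F (Poly_Mapping.single 0 c * p) q = Poly_Mapping.single 0 c * F p q"
    and "\<And>c p q. F p (Poly_Mapping.single 0 c * q) = Poly_Mapping.single 0 c * F p q"
    and "\<And>c p q. G (Poly_Mapping.single 0 c * p) q = Poly_Mapping.single 0 c * G p q"
    and "\<And>c p q. G p (Poly_Mapping.single 0 c * q) = Poly_Mapping.single 0 c * G p q"
    and eq: "\<And>xs ys. F (mon xs) (mon ys) = G (mon xs) (mon ys)"
  shows "F p q = G p q"
proof (induction p rule: free_induct)
  case zero
  then show ?case using assms(5,7)[of 0 0 q] by simp
next
  case (add p p')
  then show ?case using assms by simp
next
  case (single w c)
  have "F (mon (letters w)) q = G (mon (letters w)) q"
  proof (induction q rule: free_induct)
    case zero
    then show ?case using assms(6,8)[of _ 0 0] by simp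
  next
    case (add p p')
    then show ?case using assms by simp
  next
    case (single v d)
    then show ?case by (subst (1 2) single_eq_mon) (simp only: assms)
  qed
  then show ?case by (subst (1 2) single_eq_mon) (simp only: assms)
qed

definition sign_op :: "('n gen \<Rightarrow> nat) \<Rightarrow> 'n free \<Rightarrow> 'n free" where
  "sign_op l = lin_ext (\<lambda>xs. (-1) ^ (\<Sum>x\<leftarrow>xs. l x) * mon xs)"

lemma minus_one_power_central: "p * (-1) ^ k = (-1) ^ k * p" for p :: "'a::ring_1"
  by (cases "even k") simp_all

lemma scalar_left_comm:
  "p * (Poly_Mapping.single 0 c * q) = Poly_Mapping.single 0 c * (p * q)" for p q :: "'n free"
  by (metis mult.assoc scalar_central)

lemma sign_op_mult: "sign_op l (p * q) = sign_op l p * sign_op l q"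
proof (rule bilinear_ext[where F = "\<lambda>p q. sign_op l (p * q)"
      and G = "\<lambda>p q. sign_op l p * sign_op l q"])
  fix xs ys :: "'a gen list"
  show "sign_op l (mon xs * mon ys) = sign_op l (mon xs) * sign_op l (mon ys)"
    unfolding sign_op_def mon_append[symmetric] lin_ext_mon
    by (cases "even (\<Sum>x\<leftarrow>ys. l x)") (simp_all add: mon_append power_add mult.assoc)
qed (simp_all add: sign_op_def lin_ext_add distrib_left distrib_right lin_ext_scalar scalar_left_comm
    mult.assoc)

lemma deriv_word_append:
  "deriv_word l r \<delta> (xs @ ys) =
     (-1) ^ (\<Sum>x\<leftarrow>xs. l x) * mon xs * deriv_word l r \<delta> ys
   + deriv_word l r \<delta> xs * ((-1) ^ (\<Sum>y\<leftarrow>ys. r y) * mon ys)"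
proof (induction xs)
  case Nil
  then show ?case by simp
next
  case (Cons x xs)
  define s where "s = (\<Sum>x\<leftarrow>xs. l x)"
  define t where "t = (\<Sum>x\<leftarrow>xs. r x)"
  define u where "u = (\<Sum>x\<leftarrow>ys. r x)"
  show ?case
    unfolding append_Cons deriv_word.simps Cons.IH list.map sum_list.Cons map_append
      sum_list_append s_def[symmetric] t_def[symmetric] u_def[symmetric] mon_Cons[of x xs]
    by (cases "even s"; cases "even t"; cases "even u"; cases "even (l x)")
      (simp_all add: algebra_simps mon_append)
qed

lemma deriv_free_add: "deriv_free l r \<delta> (p + q) = deriv_free l r \<delta> p + deriv_free l r \<delta> q"
  by (simp add: deriv_free_def lin_ext_add)

lemma deriv_free_zero: "deriv_free l r \<delta> 0 = 0"
  by (simp add: deriv_free_def)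

lemma deriv_free_uminus: "deriv_free l r \<delta> (- p) = - deriv_free l r \<delta> p"
  by (simp add: deriv_free_def lin_ext_uminus)

lemma deriv_free_diff: "deriv_free l r \<delta> (p - q) = deriv_free l r \<delta> p - deriv_free l r \<delta> q"
  by (simp add: deriv_free_def lin_ext_diff)

lemma deriv_free_mult:
  "deriv_free l r \<delta> (p * q) = sign_op l p * deriv_free l r \<delta> q + deriv_free l r \<delta> p * sign_op r q"
proof (rule bilinear_ext[where F = "\<lambda>p q. deriv_free l r \<delta> (p * q)"
      and G = "\<lambda>p q. sign_op l p * deriv_free l r \<delta> q + deriv_free l r \<delta> p * sign_op r q"])
  fix xs ys :: "'a gen list"
  show "deriv_free l r \<delta> (mon xs * mon ys) =
     sign_op l (mon xs) * deriv_free l r \<delta> (mon ys) + deriv_free l r \<delta> (mon xs) * sign_op r (mon ys)"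
    unfolding deriv_free_def sign_op_def mon_append[symmetric] lin_ext_mon by (rule deriv_word_append)
qed (simp_all add: deriv_free_def sign_op_def lin_ext_add distrib_left distrib_right lin_ext_scalar
    scalar_left_comm mult.assoc add.assoc add.left_commute)

lemma deriv_free_gen: "deriv_free l r \<delta> (gen x) = \<delta> x"
  by (simp add: deriv_free_def)

lemma sign_op_gen: "sign_op l (gen x) = (-1) ^ l x * gen x"
  by (simp add: sign_op_def)

lemma deriv_free_one: "deriv_free l r \<delta> 1 = 0"
  unfolding mon_Nil[symmetric] deriv_free_def lin_ext_mon by simp

lemma sign_op_one: "sign_op l 1 = 1"
  unfolding mon_Nil[symmetric] sign_op_def lin_ext_mon by simp

lemma deriv_free_sign: "deriv_free l r \<delta> ((-1) ^ k * p) = (-1) ^ k * deriv_free l r \<delta> p"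
  by (cases "even k") (simp_all add: deriv_free_uminus)

lemma sign_op_linear:
  "sign_op l (p + q) = sign_op l p + sign_op l q"
  "sign_op l (p - q) = sign_op l p - sign_op l q"
  "sign_op l (- p) = - sign_op l p"
  "sign_op l 0 = 0"
  by (simp_all add: sign_op_def lin_ext_add lin_ext_diff lin_ext_uminus)

lemma sign_op_sign: "sign_op l ((-1) ^ k * p) = (-1) ^ k * sign_op l p"
  by (cases "even k") (simp_all add: sign_op_linear)

text \<open>The relations are homogeneous for every grading read off from the components.\<close>

lemma sign_op_relations:
  assumes "q \<in> relations" "l = form_deg \<or> l = grassmann \<or> l = (\<lambda>_. 0)"
  shows "\<exists>k. sign_op l q = (-1) ^ k * q"
  using assms(1)
proof cases
  case (super_comm x y)
  have "sign_op l q = (-1) ^ (l x + l y) * q"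
    unfolding super_comm sign_op_linear sign_op_mult sign_op_sign sign_op_gen
    by (cases "even (l x)"; cases "even (l y)"; cases "even (parity x * parity y)")
      (simp_all add: sign_op_linear sign_op_mult sign_op_gen sign_op_one)
  then show ?thesis ..
qed (insert assms(2), auto simp: sign_op_gen sign_op_linear intro: exI[of _ 0] exI[of _ 1])

lemma sign_op_ideal:
  assumes "q \<in> rel_ideal" "l = form_deg \<or> l = grassmann \<or> l = (\<lambda>_. 0)"
  shows "sign_op l q \<in> rel_ideal"
  using assms(1)
proof induction
  case (rel q p r)
  obtain k where "sign_op l q = (-1) ^ k * q" using sign_op_relations[OF rel assms(2)] by blast
  then have "sign_op l (p * q * r) = (-1) ^ k * (sign_op l p * q * sign_op l r)"
    by (cases "even k") (simp_all add: sign_op_mult)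
  then show ?case using rel by (auto intro!: rel_ideal_mult_left rel_ideal.rel)
qed (auto simp: sign_op_linear intro: rel_ideal.intros)

lemma deriv_free_ideal:
  assumes "\<And>q. q \<in> relations \<Longrightarrow> deriv_free l r \<delta> q \<in> rel_ideal"
    and "l = form_deg \<or> l = grassmann \<or> l = (\<lambda>_. 0)" "r = form_deg \<or> r = grassmann \<or> r = (\<lambda>_. 0)"
    and "p \<in> rel_ideal"
  shows "deriv_free l r \<delta> p \<in> rel_ideal"
  using assms(4)
proof induction
  case zero
  then show ?case by (simp add: deriv_free_def rel_ideal.zero)
next
  case (add p q)
  then show ?case by (simp add: deriv_free_add rel_ideal.add)
next
  case (rel q p s)
  then have "q \<in> rel_ideal" by (rule relations_in_ideal)
  then show ?case unfolding deriv_free_mult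
    by (intro rel_ideal.add rel_ideal_mult_left rel_ideal_mult_right sign_op_ideal assms(1-3)
        rel_ideal.rel[OF rel])
      (auto simp: sign_op_mult intro!: rel_ideal_mult_left rel_ideal_mult_right rel_ideal.add
        sign_op_ideal assms(1-3) rel)
qed

lemma super_comm_ideal: "gen x * gen y - (-1) ^ (parity x * parity y) * (gen y * gen x) \<in> rel_ideal"
  using relations.super_comm[THEN relations_in_ideal] by (simp add: mult.assoc)

lemma partial_free_ideal:
  assumes "p \<in> rel_ideal"
  shows "partial_free \<mu> p \<in> rel_ideal"
  unfolding partial_free_def
proof (rule deriv_free_ideal[OF _ _ _ assms])
  fix q :: "'a free"
  assume "q \<in> relations"
  then show "deriv_free (\<lambda>_. 0) (\<lambda>_. 0) (partial_gen \<mu>) q \<in> rel_ideal"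
  proof cases
    case (super_comm x y)
    have par: "partial_gen \<mu> z = 0 \<or> (\<exists>z'. partial_gen \<mu> z = gen z' \<and> parity z' = parity z)" for z
      by (cases z) (auto simp: parity_def)
    define s :: "'a free" where "s = (-1) ^ (parity x * parity y)"
    have s: "deriv_free l r \<delta> (s * p) = s * deriv_free l r \<delta> p" for l r \<delta> p
      by (simp add: s_def deriv_free_sign)
    have "deriv_free (\<lambda>_. 0) (\<lambda>_. 0) (partial_gen \<mu>) (gen a * gen b)
        = gen a * partial_gen \<mu> b + partial_gen \<mu> a * gen b" for a b :: "'a gen"
      by (simp add: deriv_free_mult deriv_free_gen sign_op_gen)
    then have "deriv_free (\<lambda>_. 0) (\<lambda>_. 0) (partial_gen \<mu>) q =
        (gen x * partial_gen \<mu> y - s * (partial_gen \<mu> y * gen x))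
      + (partial_gen \<mu> x * gen y - s * (gen y * partial_gen \<mu> x))"
      unfolding super_comm s_def[symmetric] mult.assoc deriv_free_diff s
      by (simp add: algebra_simps)
    moreover have "gen x * partial_gen \<mu> y - s * (partial_gen \<mu> y * gen x) \<in> rel_ideal"
      using par[of y] super_comm_ideal[of x] unfolding s_def by (metis mult_zero_left mult_zero_right
          diff_self rel_ideal.zero)
    moreover have "partial_gen \<mu> x * gen y - s * (gen y * partial_gen \<mu> x) \<in> rel_ideal"
      using par[of x] super_comm_ideal[of _ y] unfolding s_def by (metis mult_zero_left mult_zero_right
          diff_self rel_ideal.zero)
    ultimately show ?thesis by (simp add: rel_ideal.add)
  qed (simp_all only: deriv_free_add deriv_free_diff deriv_free_gen partial_gen.simps
      relations.intros[THEN relations_in_ideal])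
qed auto

lemma gamma_gen_parity:
  assumes "even k \<longleftrightarrow> even (parity y) \<or> odd (parity x)"
  shows "gamma_gen x * gen y - (-1) ^ k * (gen y * gamma_gen x) \<in> rel_ideal"
    (is "?comm (gamma_gen x) \<in> _")
proof -
  have gen: "?comm (gen z) \<in> rel_ideal" if "odd (parity z + parity x)" for z
  proof -
    have "(-1) ^ k = ((-1) ^ (parity z * parity y) :: 'a free)"
      using assms that by (cases "even k") auto
    then show ?thesis using super_comm_ideal[of z y] by simp
  qed
  have add: "?comm (p + q) \<in> rel_ideal" and diff: "?comm (p - q) \<in> rel_ideal"
    if "?comm p \<in> rel_ideal" "?comm q \<in> rel_ideal" for p q
    using rel_ideal.add[OF that] rel_ideal_diff[OF that] by (simp_all add: algebra_simps)
  show ?thesis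
  proof (cases x rule: gamma_gen.cases)
    case (1 m \<mu> \<nu> \<alpha> \<beta>)
    then show ?thesis by (auto simp: parity_def intro!: add diff gen)
  next
    case (2 m \<mu> \<nu> \<alpha>)
    then show ?thesis unfolding gamma_gen.simps mult_2
      by (auto simp: parity_def mult_2 intro!: add diff gen)
  qed (simp_all add: rel_ideal.zero)
qed

lemma hook_in_ideal:
  "gen (Jet m (Eta \<mu> \<nu> \<alpha>)) + gen (Jet m (Eta \<nu> \<mu> \<alpha>)) \<in> rel_ideal"
  "gen (Jet m (Eta \<mu> \<nu> \<alpha>)) + gen (Jet m (Eta \<nu> \<alpha> \<mu>)) + gen (Jet m (Eta \<alpha> \<mu> \<nu>)) \<in> rel_ideal"
  by (rule relations_in_ideal, rule relations.intros, simp)+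

lemma two_in_ideal: "gen (Jet m (Cghost \<mu> \<nu>)) + gen (Jet m (Cghost \<nu> \<mu>)) \<in> rel_ideal"
  by (rule relations_in_ideal, rule relations.intros, simp)

lemma gamma_free_ideal:
  assumes "p \<in> rel_ideal"
  shows "gamma_free p \<in> rel_ideal"
  unfolding gamma_free_def
proof (rule deriv_free_ideal[OF _ _ _ assms])
  let ?D = "deriv_free form_deg grassmann gamma_gen"
  fix q :: "'a free"
  assume "q \<in> relations"
  then show "?D q \<in> rel_ideal"
  proof cases
    case (super_comm x y)
    define X where "X = gamma_gen y * gen x - (-1) ^ (parity x * (parity y + 1)) * (gen x * gamma_gen y)"
    define Y where "Y = gamma_gen x * gen y - (-1) ^ (parity y * (parity x + 1)) * (gen y * gamma_gen x)"
    have "X \<in> rel_ideal" "Y \<in> rel_ideal"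
      unfolding X_def Y_def by (rule gamma_gen_parity; auto)+
    moreover have "?D q = - ((-1) ^ (form_deg x + parity x * (parity y + 1)) * X) + (-1) ^ grassmann y * Y"
    proof -
      have "?D (gen a * gen b) = (-1) ^ form_deg a * (gen a * gamma_gen b)
          + (-1) ^ grassmann b * (gamma_gen a * gen b)" for a b :: "'a gen"
        by (cases "even (grassmann b)") (simp_all add: deriv_free_mult deriv_free_gen sign_op_gen mult.assoc)
      then show ?thesis
        unfolding super_comm mult.assoc deriv_free_diff deriv_free_sign X_def Y_def parity_def
        by (cases "even (form_deg x)"; cases "even (grassmann x)"; cases "even (form_deg y)";
            cases "even (grassmann y)") (simp_all add: algebra_simps)
    qed
    ultimately show ?thesis
      by (simp add: rel_ideal_diff rel_ideal_mult_left)
  next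
    case (riem_antisym1 \<Phi> m \<mu> \<nu> \<alpha> \<beta>)
    have "?D (gen (Jet m (Tfield \<mu> \<nu> \<alpha> \<beta>)) + gen (Jet m (Tfield \<nu> \<mu> \<alpha> \<beta>))) =
        (gen (Jet (add_mset \<alpha> m) (Eta \<mu> \<nu> \<beta>)) + gen (Jet (add_mset \<alpha> m) (Eta \<nu> \<mu> \<beta>)))
      - (gen (Jet (add_mset \<beta> m) (Eta \<mu> \<nu> \<alpha>)) + gen (Jet (add_mset \<beta> m) (Eta \<nu> \<mu> \<alpha>)))"
      by (simp add: deriv_free_add deriv_free_gen)
    also have "\<dots> \<in> rel_ideal" by (intro rel_ideal_diff hook_in_ideal)
    finally show ?thesis
      using riem_antisym1 by (auto simp: deriv_free_add deriv_free_gen rel_ideal.zero)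
  next
    case (riem_antisym2 \<Phi> m \<mu> \<nu> \<alpha> \<beta>)
    have "?D (gen (Jet m (Tfield \<mu> \<nu> \<alpha> \<beta>)) + gen (Jet m (Tfield \<mu> \<nu> \<beta> \<alpha>))) =
        (gen (Jet (add_mset \<mu> m) (Eta \<alpha> \<beta> \<nu>)) + gen (Jet (add_mset \<mu> m) (Eta \<beta> \<alpha> \<nu>)))
      - (gen (Jet (add_mset \<nu> m) (Eta \<alpha> \<beta> \<mu>)) + gen (Jet (add_mset \<nu> m) (Eta \<beta> \<alpha> \<mu>)))"
      by (simp add: deriv_free_add deriv_free_gen)
    also have "\<dots> \<in> rel_ideal" by (intro rel_ideal_diff hook_in_ideal)
    finally show ?thesis
      using riem_antisym2 by (auto simp: deriv_free_add deriv_free_gen rel_ideal.zero)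
  next
    case (riem_pair \<Phi> m \<mu> \<nu> \<alpha> \<beta>)
    then show ?thesis by (auto simp: deriv_free_diff deriv_free_gen rel_ideal.zero)
  next
    case (riem_cyclic \<Phi> m \<mu> \<nu> \<alpha> \<beta>)
    let ?E = "\<lambda>\<rho> a b c. gen (Jet (add_mset \<rho> m) (Eta a b c))"
    have "?D (gen (Jet m (Tfield \<mu> \<nu> \<alpha> \<beta>)) + gen (Jet m (Tfield \<nu> \<alpha> \<mu> \<beta>)) + gen (Jet m (Tfield \<alpha> \<mu> \<nu> \<beta>))) =
        ((?E \<mu> \<alpha> \<beta> \<nu> + ?E \<mu> \<beta> \<nu> \<alpha> + ?E \<mu> \<nu> \<alpha> \<beta>) - (?E \<mu> \<nu> \<beta> \<alpha> + ?E \<mu> \<beta> \<nu> \<alpha>))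
      + ((?E \<nu> \<mu> \<beta> \<alpha> + ?E \<nu> \<beta> \<alpha> \<mu> + ?E \<nu> \<alpha> \<mu> \<beta>) - (?E \<nu> \<alpha> \<beta> \<mu> + ?E \<nu> \<beta> \<alpha> \<mu>))
      + ((?E \<alpha> \<nu> \<beta> \<mu> + ?E \<alpha> \<beta> \<mu> \<nu> + ?E \<alpha> \<mu> \<nu> \<beta>) - (?E \<alpha> \<mu> \<beta> \<nu> + ?E \<alpha> \<beta> \<mu> \<nu>))
      - (?E \<beta> \<mu> \<nu> \<alpha> + ?E \<beta> \<nu> \<alpha> \<mu> + ?E \<beta> \<alpha> \<mu> \<nu>)"
      by (simp add: deriv_free_add deriv_free_gen)
    also have "\<dots> \<in> rel_ideal" by (intro rel_ideal_diff rel_ideal.add hook_in_ideal)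
    finally show ?thesis
      using riem_cyclic by (auto simp: deriv_free_add deriv_free_gen rel_ideal.zero)
  next
    case (hook_antisym \<Phi> m \<mu> \<nu> \<alpha>)
    have "?D (gen (Jet m (Eta \<mu> \<nu> \<alpha>)) + gen (Jet m (Eta \<nu> \<mu> \<alpha>))) =
        2 * (gen (Jet (add_mset \<alpha> m) (Cghost \<mu> \<nu>)) + gen (Jet (add_mset \<alpha> m) (Cghost \<nu> \<mu>)))"
      by (simp add: deriv_free_add deriv_free_gen distrib_left)
    also have "\<dots> \<in> rel_ideal" by (intro rel_ideal_mult_left two_in_ideal)
    finally show ?thesis
      using hook_antisym by (auto simp: deriv_free_add deriv_free_gen rel_ideal.zero)
  next
    case (hook_cyclic \<Phi> m \<mu> \<nu> \<alpha>)
    let ?C = "\<lambda>\<rho> a b. gen (Jet (add_mset \<rho> m) (Cghost a b))"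
    have "?D (gen (Jet m (Eta \<mu> \<nu> \<alpha>)) + gen (Jet m (Eta \<nu> \<alpha> \<mu>)) + gen (Jet m (Eta \<alpha> \<mu> \<nu>))) =
        (?C \<alpha> \<mu> \<nu> + ?C \<alpha> \<nu> \<mu>) + (?C \<mu> \<nu> \<alpha> + ?C \<mu> \<alpha> \<nu>) + (?C \<nu> \<alpha> \<mu> + ?C \<nu> \<mu> \<alpha>)"
      by (simp add: deriv_free_add deriv_free_gen mult_2)
    also have "\<dots> \<in> rel_ideal" by (intro rel_ideal.add two_in_ideal)
    finally show ?thesis
      using hook_cyclic by (auto simp: deriv_free_add deriv_free_gen rel_ideal.zero)
  next
    case (two_antisym \<Phi> m \<mu> \<nu>)
    then show ?thesis by (auto simp: deriv_free_add deriv_free_gen rel_ideal.zero)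
  qed
qed auto

lemma one_notin_ideal: "1 \<notin> rel_ideal"
proof -
  have mult: "Poly_Mapping.lookup (p * q) 0 = Poly_Mapping.lookup p 0 * Poly_Mapping.lookup q 0"
    for p q :: "'a free"
  proof (induction p rule: free_induct)
    case (single w c)
    have zero: "v + u = 0 \<longleftrightarrow> v = 0 \<and> u = 0" for v u :: "'a gen word"
      by (cases v; cases u) (auto simp: zero_word_def plus_word_def)
    show ?case
      by (induction q rule: free_induct)
        (auto simp: distrib_left lookup_add mult_single lookup_single when_def zero)
  qed (simp_all add: distrib_right lookup_add)
  have gen: "Poly_Mapping.lookup (gen x) 0 = 0" for x :: "'a gen"
    by (simp add: mon_def lookup_single when_def zero_word_def)
  have rels: "Poly_Mapping.lookup q 0 = 0" if "q \<in> relations" for q :: "'a free"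
    using that by cases (simp_all add: lookup_add lookup_minus mult gen)
  have "Poly_Mapping.lookup q 0 = 0" if "q \<in> rel_ideal" for q :: "'a free"
    using that by induction (simp_all add: lookup_add mult rels)
  then show ?thesis by (metis lookup_one_zero zero_neq_one)
qed


section \<open>The algebra of local forms\<close>

quotient_type 'n local_form = "'n free" / "\<lambda>p q. p - q \<in> rel_ideal"
  morphisms rep_local_form abs_local_form
proof (rule equivpI)
  show "reflp (\<lambda>p q. p - q \<in> (rel_ideal :: 'n free set))"
    by (simp add: reflp_def rel_ideal.zero)
  show "symp (\<lambda>p q. p - q \<in> (rel_ideal :: 'n free set))"
  proof (rule sympI)
    fix p q :: "'n free"
    assume "p - q \<in> rel_ideal"
    then have "- (p - q) \<in> rel_ideal" by (rule rel_ideal_uminus)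
    then show "q - p \<in> rel_ideal" by simp
  qed
  show "transp (\<lambda>p q. p - q \<in> (rel_ideal :: 'n free set))"
  proof (rule transpI)
    fix p q r :: "'n free"
    assume "p - q \<in> rel_ideal" "q - r \<in> rel_ideal"
    then have "(p - q) + (q - r) \<in> rel_ideal" by (rule rel_ideal.add)
    then show "p - r \<in> rel_ideal" by simp
  qed
qed

instantiation local_form :: (type) ring_1
begin

lift_definition zero_local_form :: "'a local_form" is 0 .
lift_definition one_local_form :: "'a local_form" is 1 .
lift_definition plus_local_form :: "'a local_form \<Rightarrow> 'a local_form \<Rightarrow> 'a local_form" is "(+)"
proof -
  fix p p' q q' :: "'a free"
  assume "p - p' \<in> rel_ideal" "q - q' \<in> rel_ideal"
  then have "(p - p') + (q - q') \<in> rel_ideal" by (rule rel_ideal.add)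
  then show "(p + q) - (p' + q') \<in> rel_ideal" by (simp add: algebra_simps)
qed
lift_definition minus_local_form :: "'a local_form \<Rightarrow> 'a local_form \<Rightarrow> 'a local_form" is "(-)"
proof -
  fix p p' q q' :: "'a free"
  assume "p - p' \<in> rel_ideal" "q - q' \<in> rel_ideal"
  then have "(p - p') - (q - q') \<in> rel_ideal" by (rule rel_ideal_diff)
  then show "(p - q) - (p' - q') \<in> rel_ideal" by (simp add: algebra_simps)
qed
lift_definition uminus_local_form :: "'a local_form \<Rightarrow> 'a local_form" is uminus
proof -
  fix p p' :: "'a free"
  assume "p - p' \<in> rel_ideal"
  then have "- (p - p') \<in> rel_ideal" by (rule rel_ideal_uminus)
  then show "- p - - p' \<in> rel_ideal" by simp
qed
lift_definition times_local_form :: "'a local_form \<Rightarrow> 'a local_form \<Rightarrow> 'a local_form" is "(*)"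
proof -
  fix p p' q q' :: "'a free"
  assume "p - p' \<in> rel_ideal" "q - q' \<in> rel_ideal"
  then have "(p - p') * q + p' * (q - q') \<in> rel_ideal"
    by (intro rel_ideal.add rel_ideal_mult_left rel_ideal_mult_right)
  then show "p * q - p' * q' \<in> rel_ideal" by (simp add: algebra_simps)
qed

instance
proof
  have "0 - 1 \<notin> (rel_ideal :: 'a free set)"
  proof
    assume "0 - 1 \<in> (rel_ideal :: 'a free set)"
    then have "- (0 - 1) \<in> (rel_ideal :: 'a free set)" by (rule rel_ideal_uminus)
    then show False by (simp add: one_notin_ideal)
  qed
  then show "(0::'a local_form) \<noteq> 1" by transfer
  fix a b c :: "'a local_form"
  show "a * b * c = a * (b * c)" by transfer (simp only: mult.assoc diff_self rel_ideal.zero)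
  show "a + b + c = a + (b + c)" by transfer (simp only: add.assoc diff_self rel_ideal.zero)
  show "a + b = b + a" by transfer (simp only: add.commute diff_self rel_ideal.zero)
  show "0 + a = a" by transfer (simp only: add_0_left diff_self rel_ideal.zero)
  show "- a + a = 0" by transfer (simp only: left_minus diff_self rel_ideal.zero)
  show "a - b = a + - b" by transfer (simp only: diff_conv_add_uminus right_minus rel_ideal.zero)
  show "1 * a = a" by transfer (simp only: mult_1_left diff_self rel_ideal.zero)
  show "a * 1 = a" by transfer (simp only: mult_1_right diff_self rel_ideal.zero)
  show "(a + b) * c = a * c + b * c" by transfer (simp only: distrib_right diff_self rel_ideal.zero)
  show "a * (b + c) = a * b + a * c" by transfer (simp only: distrib_left diff_self rel_ideal.zero)
qed

end

lift_definition dx :: "'n \<Rightarrow> 'n local_form" is "\<lambda>\<mu>. gen (Dx \<mu>)" .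

lift_definition total_deriv :: "'n \<Rightarrow> 'n local_form \<Rightarrow> 'n local_form" is partial_free
  by (simp add: partial_free_ideal partial_free_def flip: deriv_free_diff)
    (simp add: partial_free_ideal flip: partial_free_def)

lift_definition gamma :: "'n local_form \<Rightarrow> 'n local_form" is gamma_free
  by (simp add: gamma_free_def flip: deriv_free_diff)
    (simp add: gamma_free_ideal flip: gamma_free_def)

definition ext_d :: "'n::finite local_form \<Rightarrow> 'n local_form" where
  "ext_d a = (\<Sum>\<mu>\<in>UNIV. dx \<mu> * total_deriv \<mu> a)"

subsection \<open>Properties of the two differentials\<close>

lemma free_eqI:
  assumes "\<And>xs. F (mon xs) = G (mon xs)"
    and "\<And>p q. F (p + q) = F p + F q" "\<And>p q. G (p + q) = G p + G q"
    and "\<And>c p. F (Poly_Mapping.single 0 c * p) = Poly_Mapping.single 0 c * F p"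
    and "\<And>c p. G (Poly_Mapping.single 0 c * p) = Poly_Mapping.single 0 c * G p"
  shows "F p = (G p :: 'n free)"
proof (induction p rule: free_induct)
  case zero
  then show ?case using assms(4,5)[of 0 0] by simp
next
  case (single w c)
  then show ?case by (subst (1 2) single_eq_mon) (simp only: assms)
qed (simp only: assms)

lemma deriv_free_scalar:
  "deriv_free l r \<delta> (Poly_Mapping.single 0 c * p) = Poly_Mapping.single 0 c * deriv_free l r \<delta> p"
  by (simp add: deriv_free_def lin_ext_scalar)

lemma sign_op_scalar:
  "sign_op l (Poly_Mapping.single 0 c * p) = Poly_Mapping.single 0 c * sign_op l p"
  by (simp add: sign_op_def lin_ext_scalar)

lemma sign_op_mon: "sign_op l (mon xs) = (-1) ^ (\<Sum>x\<leftarrow>xs. l x) * mon xs"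
  by (simp add: sign_op_def)

lemma sign_op_trivial: "sign_op (\<lambda>_. 0) p = p"
  by (rule free_eqI) (simp_all add: sign_op_mon sign_op_linear sign_op_scalar)

lemma sign_op_involution: "sign_op l (sign_op l p) = p"
  by (rule free_eqI)
    (simp_all add: sign_op_mon sign_op_linear sign_op_scalar sign_op_sign flip: mult.assoc power_add)

lemma partial_free_mult: "partial_free \<mu> (p * q) = p * partial_free \<mu> q + partial_free \<mu> p * q"
  by (simp add: partial_free_def deriv_free_mult sign_op_trivial)

lemma gamma_free_mult:
  "gamma_free (p * q) = sign_op form_deg p * gamma_free q + gamma_free p * sign_op grassmann q"
  by (simp add: gamma_free_def deriv_free_mult)

lemma partial_free_linear:
  "partial_free \<mu> (p + q) = partial_free \<mu> p + partial_free \<mu> q"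
  "partial_free \<mu> (p - q) = partial_free \<mu> p - partial_free \<mu> q"
  "partial_free \<mu> (Poly_Mapping.single 0 c * p) = Poly_Mapping.single 0 c * partial_free \<mu> p"
  "partial_free \<mu> ((-1) ^ k * p) = (-1) ^ k * partial_free \<mu> p"
  "partial_free \<mu> (gen x) = partial_gen \<mu> x"
  "partial_free \<mu> 1 = 0"
  "partial_free \<mu> 0 = 0"
  by (simp_all add: partial_free_def deriv_free_add deriv_free_diff deriv_free_scalar deriv_free_sign
      deriv_free_gen deriv_free_one deriv_free_zero)

lemma partial_free_uminus: "partial_free \<mu> (- p) = - partial_free \<mu> p"
  by (simp add: partial_free_def deriv_free_uminus)

lemma gamma_free_linear:
  "gamma_free (p + q) = gamma_free p + gamma_free q"
  "gamma_free (p - q) = gamma_free p - gamma_free q"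
  "gamma_free (Poly_Mapping.single 0 c * p) = Poly_Mapping.single 0 c * gamma_free p"
  "gamma_free ((-1) ^ k * p) = (-1) ^ k * gamma_free p"
  "gamma_free (gen x) = gamma_gen x"
  "gamma_free 1 = 0"
  "gamma_free 0 = 0"
  by (simp_all add: gamma_free_def deriv_free_add deriv_free_diff deriv_free_scalar deriv_free_sign
      deriv_free_gen deriv_free_one deriv_free_zero)

lemma gamma_free_uminus: "gamma_free (- p) = - gamma_free p"
  by (simp add: gamma_free_def deriv_free_uminus)

lemma sign_op_partial_free:
  assumes "l = form_deg \<or> l = grassmann"
  shows "sign_op l (partial_free \<mu> p) = partial_free \<mu> (sign_op l p)"
proof (rule free_eqI[where F = "\<lambda>p. sign_op l (partial_free \<mu> p)"])
  fix xs :: "'a gen list"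
  have gen: "sign_op l (partial_gen \<mu> x) = (-1) ^ l x * partial_gen \<mu> x" for x :: "'a gen"
    using assms by (cases x) (auto simp: sign_op_gen sign_op_linear)
  show "sign_op l (partial_free \<mu> (mon xs)) = partial_free \<mu> (sign_op l (mon xs))"
  proof (induction xs)
    case Nil
    then show ?case by (simp add: sign_op_one sign_op_linear partial_free_linear)
  next
    case (Cons x xs)
    then show ?case
      unfolding mon_Cons[of x xs] partial_free_mult sign_op_mult sign_op_linear sign_op_gen
        partial_free_linear(5) gen
      by (cases "even (l x)") (simp_all add: partial_free_linear partial_free_uminus partial_free_mult)
  qed
qed (simp_all add: sign_op_linear sign_op_scalar partial_free_linear)

lemma gamma_gen_partial: "gamma_free (partial_gen \<mu> x) = partial_free \<mu> (gamma_gen x)"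
proof (cases x rule: gamma_gen.cases)
  case (2 m \<mu> \<nu> \<alpha>)
  then show ?thesis
    by (simp add: gamma_free_linear partial_free_linear mult_2 add_mset_commute)
qed (simp_all add: gamma_free_linear partial_free_linear add_mset_commute)

lemma gamma_free_partial_free: "gamma_free (partial_free \<mu> p) = partial_free \<mu> (gamma_free p)"
proof (rule free_eqI[where F = "\<lambda>p. gamma_free (partial_free \<mu> p)"])
  fix xs :: "'a gen list"
  show "gamma_free (partial_free \<mu> (mon xs)) = partial_free \<mu> (gamma_free (mon xs))"
  proof (induction xs)
    case Nil
    show ?case
      by (simp add: gamma_free_linear partial_free_linear)
  next
    case (Cons x xs)
    have "sign_op form_deg (partial_gen \<mu> x) = partial_free \<mu> (sign_op form_deg (gen x))"
      using sign_op_partial_free[of form_deg \<mu> "gen x"] by (simp add: partial_free_linear)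
    then show ?case
      unfolding mon_Cons[of x xs]
      by (simp add: partial_free_mult gamma_free_mult partial_free_linear gamma_free_linear Cons
          sign_op_partial_free gamma_gen_partial add_ac)
  qed
qed (simp_all add: gamma_free_linear partial_free_linear)

lemma sign_op_gamma_free:
  "sign_op form_deg (gamma_free p) = gamma_free (sign_op form_deg p)" (is ?F)
  "sign_op grassmann (gamma_free p) = - gamma_free (sign_op grassmann p)" (is ?G)
proof -
  have gen: "sign_op form_deg (gamma_gen x) = (-1) ^ form_deg x * gamma_gen x"
    "sign_op grassmann (gamma_gen x) = - ((-1) ^ grassmann x * gamma_gen x)" for x :: "'a gen"
    by (cases x rule: gamma_gen.cases; simp add: sign_op_linear sign_op_gen mult_2)+
  have mon: "sign_op form_deg (gamma_free (mon xs)) = gamma_free (sign_op form_deg (mon xs)) \<and>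
      sign_op grassmann (gamma_free (mon xs)) = - gamma_free (sign_op grassmann (mon xs))"
    for xs :: "'a gen list"
  proof (induction xs)
    case Nil
    then show ?case by (simp add: sign_op_one sign_op_linear gamma_free_linear)
  next
    case (Cons x xs)
    have comm: "sign_op form_deg (sign_op grassmann p) = sign_op grassmann (sign_op form_deg p)" for p :: "'a free"
      by (rule free_eqI[where F = "\<lambda>p. sign_op form_deg (sign_op grassmann p)"])
        (simp_all add: sign_op_mon sign_op_sign sign_op_linear sign_op_scalar mult.left_commute
          flip: mult.assoc power_add, simp add: add.commute)
    show ?case using Cons
      unfolding mon_Cons[of x xs] sign_op_mult gamma_free_mult sign_op_linear(1) comm
      by (cases "even (form_deg x)"; cases "even (grassmann x)")
        (simp_all add: sign_op_gen sign_op_linear gamma_free_linear gamma_free_uminus gen algebra_simps)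
  qed
  show ?F by (rule free_eqI[where F = "\<lambda>p. sign_op form_deg (gamma_free p)"]) (simp_all add: mon sign_op_linear sign_op_scalar gamma_free_linear)
  show ?G by (rule free_eqI[where F = "\<lambda>p. sign_op grassmann (gamma_free p)"]) (simp_all add: mon sign_op_linear sign_op_scalar gamma_free_linear)
qed

lemma gamma_free_gamma_free: "gamma_free (gamma_free p) \<in> rel_ideal"
proof -
  have gen: "gamma_free (gamma_gen x) \<in> rel_ideal" for x :: "'a gen"
  proof (cases x rule: gamma_gen.cases)
    case (1 m \<mu> \<nu> \<alpha> \<beta>)
    let ?C = "\<lambda>\<rho> \<sigma> a b. gen (Jet (add_mset \<rho> (add_mset \<sigma> m)) (Cghost a b))"
    have "gamma_free (gamma_gen x) =
        2 * (?C \<alpha> \<beta> \<mu> \<nu> - ?C \<alpha> \<beta> \<mu> \<nu>)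
      + ((?C \<mu> \<beta> \<alpha> \<nu> + ?C \<mu> \<beta> \<nu> \<alpha>) - (?C \<mu> \<alpha> \<beta> \<nu> + ?C \<mu> \<alpha> \<nu> \<beta>))
      + ((?C \<nu> \<alpha> \<beta> \<mu> + ?C \<nu> \<alpha> \<mu> \<beta>) - (?C \<nu> \<beta> \<alpha> \<mu> + ?C \<nu> \<beta> \<mu> \<alpha>))"
      unfolding 1 gamma_gen.simps gamma_free_linear mult_2
      by (simp add: algebra_simps add_mset_commute)
    also have "\<dots> \<in> rel_ideal" by (simp add: rel_ideal_diff rel_ideal.add two_in_ideal)
    finally show ?thesis .
  next
    case (2 m \<mu> \<nu> \<alpha>)
    then show ?thesis by (simp add: gamma_free_linear mult_2 rel_ideal.zero)
  qed (simp_all add: gamma_free_linear rel_ideal.zero)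
  have mon: "gamma_free (gamma_free (mon xs)) \<in> rel_ideal" for xs :: "'a gen list"
  proof (induction xs)
    case Nil
    then show ?case by (simp add: gamma_free_linear rel_ideal.zero)
  next
    case (Cons x xs)
    have "gamma_free (gamma_free (gen x * mon xs)) =
        gen x * gamma_free (gamma_free (mon xs)) + gamma_free (gamma_gen x) * mon xs"
      unfolding gamma_free_mult gamma_free_linear sign_op_gamma_free sign_op_involution
        sign_op_gamma_free(1)[of "gen x", unfolded gamma_free_linear]
      by simp
    then show ?case
      unfolding mon_Cons[of x xs] by (simp add: Cons gen rel_ideal.add rel_ideal_mult_left rel_ideal_mult_right)
  qed
  show ?thesis
  proof (induction p rule: free_induct)
    case zero
    then show ?case by (simp add: gamma_free_linear rel_ideal.zero)
  next
    case (single w c)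
    then show ?case
      by (subst single_eq_mon) (simp add: gamma_free_linear rel_ideal_mult_left mon)
  qed (simp add: gamma_free_linear rel_ideal.add)
qed

lemma gamma_total_deriv: "gamma (total_deriv \<mu> a) = total_deriv \<mu> (gamma a)"
  by transfer (simp add: gamma_free_partial_free rel_ideal.zero)

lemma gamma_gamma: "gamma (gamma a) = 0"
  by transfer (simp add: gamma_free_gamma_free)

lemma gamma_add: "gamma (a + b) = gamma a + gamma b"
  by transfer (simp add: gamma_free_linear rel_ideal.zero)

lemma gamma_zero [simp]: "gamma 0 = 0"
  using gamma_add[of 0 0] by simp

lemma gamma_dx_mult: "gamma (dx \<mu> * a) = - (dx \<mu> * gamma a)"
  by transfer (simp add: gamma_free_mult gamma_free_linear sign_op_gen rel_ideal.zero)

lemma gamma_ext_d_anticommute: "gamma (ext_d a) + ext_d (gamma a) = 0"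
proof -
  have "gamma (sum f A) = (\<Sum>\<mu>\<in>A. gamma (f \<mu>))" for f :: "'a \<Rightarrow> 'a local_form" and A
    by (induction A rule: infinite_finite_induct) (simp_all add: gamma_add)
  then show ?thesis
    by (simp add: ext_d_def gamma_dx_mult gamma_total_deriv sum_negf)
qed


subsection \<open>Gradings\<close>

text \<open>
  Homogeneous elements for an additive grading of the generators: the relations are homogeneous,
  so the quotient inherits the grading. The zero form is homogeneous of every degree, and it is
  the only one of negative form degree.
\<close>

definition homogeneous :: "('n gen \<Rightarrow> int) \<Rightarrow> 'n local_form \<Rightarrow> int \<Rightarrow> bool" where
  "homogeneous f a k \<longleftrightarrow>
     (\<exists>p. a = abs_local_form p \<and> (\<forall>w\<in>Poly_Mapping.keys p. word_deg f w = k))"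

definition has_form_deg :: "'n local_form \<Rightarrow> int \<Rightarrow> bool" where
  "has_form_deg = homogeneous (\<lambda>x. int (form_deg x))"

definition has_agh :: "'n local_form \<Rightarrow> int \<Rightarrow> bool" where
  "has_agh = homogeneous (\<lambda>x. int (agh x))"

definition has_gh :: "'n local_form \<Rightarrow> int \<Rightarrow> bool" where
  "has_gh = homogeneous gh"

end

theory Submission
  imports Defs
begin

text \<open>
  No knowledge of \<open>H(\<gamma>)\<close> is needed. Let \<open>T\<^sub>n\<close> be the derivation that removes one derivative index \<open>n\<close>
  from an antifield jet variable, weighted by its antighost number. It commutes with \<open>\<gamma>\<close>, which
  does not act on antifields, and satisfies the Heisenberg relation \<open>[T\<^sub>n, \<partial>\<^sub>m] = \<delta>\<^sub>n\<^sub>m agh\<close>. Hence, with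
  \<open>i\<^sub>n\<close> the contraction dual to \<open>dx\<^sup>n\<close>, the operator \<open>b = \<Sum>\<^sub>n i\<^sub>n T\<^sub>n\<close> anticommutes with \<open>\<gamma>\<close> and
  \<open>d b + b d = k (D - p) + P\<close> in antighost number \<open>k\<close> and form degree \<open>p\<close>, where \<open>P = \<Sum>\<^sub>n \<partial>\<^sub>n T\<^sub>n\<close>. As the \<open>T\<^sub>n\<close>
  are locally nilpotent, every form is annihilated by a product of factors \<open>P - j k\<close> with \<open>j \<ge> 0\<close>. On
  cocycles \<open>P\<close> acts as \<open>-k (D - p)\<close> modulo trivial ones, so such a factor acts as the nonzero
  scalar \<open>-k (D - p + j)\<close>, and the cocycle is trivial.
\<close>

section \<open>Twisted derivations of the free algebra\<close>

abbreviation plain_deriv :: "('n gen \<Rightarrow> 'n free) \<Rightarrow> 'n free \<Rightarrow> 'n free" where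
  "plain_deriv \<equiv> deriv_free (\<lambda>_. 0) (\<lambda>_. 0)"

text \<open>The unit \<open>0\<close> of the word monoid is the empty word, so this embeds the real
  scalars into the free algebra.\<close>

definition scal :: "real \<Rightarrow> 'n free" where
  "scal c = Poly_Mapping.single 0 c"

lemma scal_0 [simp]: "scal 0 = 0"
  by (simp add: scal_def)

lemma scal_add: "scal (c + d) = scal c + scal d"
  by (simp add: scal_def single_add)

lemma scal_scal: "scal c * (scal d * p) = scal (c * d) * p"
  by (simp add: scal_def mult_single flip: mult.assoc)

lemma deriv_free_scal: "deriv_free l r \<delta> (scal c * p) = scal c * deriv_free l r \<delta> p"
  by (simp add: scal_def deriv_free_scalar)

lemma sign_op_scal: "sign_op l (scal c * p) = scal c * sign_op l p"
  by (simp add: scal_def sign_op_scalar)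

lemma scal_left_comm: "p * (scal c * q) = scal c * (p * q)"
  by (simp add: scal_def scalar_left_comm)

lemma deriv_free_two: "deriv_free l r \<delta> (2 * p) = 2 * deriv_free l r \<delta> p"
  by (simp add: mult_2 deriv_free_add)

lemmas deriv_free_linear =
  deriv_free_add deriv_free_diff deriv_free_uminus deriv_free_zero deriv_free_scalar deriv_free_sign
  deriv_free_scal deriv_free_two deriv_free_gen deriv_free_one

text \<open>A derivation that shifts the \<open>s\<close>-degree of each generator by
  \<open>m\<close> modulo 2 does so on every word, so moving \<open>sign_op s\<close> past it costs
  one overall sign.\<close>

lemma sign_op_deriv_free:
  assumes "\<And>x. sign_op s (\<delta> x) = (-1) ^ (m + s x) * \<delta> x"
  shows "sign_op s (deriv_free l r \<delta> p) = (-1) ^ m * deriv_free l r \<delta> (sign_op s p)"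
proof (rule free_eqI[where F = "\<lambda>p. sign_op s (deriv_free l r \<delta> p)"])
  fix xs :: "'a gen list"
  show "sign_op s (deriv_free l r \<delta> (mon xs)) = (-1) ^ m * deriv_free l r \<delta> (sign_op s (mon xs))"
  proof (induction xs)
    case Nil
    then show ?case by (simp add: sign_op_linear deriv_free_one sign_op_one deriv_free_zero)
  next
    case (Cons x xs)
    have comm: "sign_op s (sign_op r (mon xs)) = sign_op r (sign_op s (mon xs))"
      by (simp add: sign_op_mon sign_op_sign mult.left_commute flip: mult.assoc power_add)
        (simp add: add.commute)
    show ?case
      unfolding mon_Cons[of x xs] deriv_free_mult sign_op_mult sign_op_gen deriv_free_gen
        sign_op_linear(1) assms Cons.IH comm sign_op_sign deriv_free_sign
      by (cases "even m"; cases "even (s x)"; cases "even (l x)")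
        (simp_all add: deriv_free_linear sign_op_linear sign_op_gen sign_op_one)
  qed
qed (simp_all add: sign_op_linear sign_op_scalar deriv_free_linear scalar_left_comm distrib_left)

text \<open>The commutator of an untwisted derivation with a twisted one is again a derivation with
  the same twists, provided the first commutes with both sign operators. A commutation relation then
  only has to be checked on generators.\<close>

lemma plain_deriv_commutator:
  assumes "\<And>p. sign_op l (plain_deriv \<delta> p) = plain_deriv \<delta> (sign_op l p)"
    and "\<And>p. sign_op r (plain_deriv \<delta> p) = plain_deriv \<delta> (sign_op r p)"
  shows "plain_deriv \<delta> (deriv_free l r \<epsilon> p) = deriv_free l r \<epsilon> (plain_deriv \<delta> p)
    + deriv_free l r (\<lambda>x. plain_deriv \<delta> (\<epsilon> x) - deriv_free l r \<epsilon> (\<delta> x)) p"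
    (is "_ = _ + ?C p")
proof (rule free_eqI[where F = "\<lambda>p. plain_deriv \<delta> (deriv_free l r \<epsilon> p)"])
  fix xs :: "'a gen list"
  show "plain_deriv \<delta> (deriv_free l r \<epsilon> (mon xs)) = deriv_free l r \<epsilon> (plain_deriv \<delta> (mon xs)) + ?C (mon xs)"
  proof (induction xs)
    case Nil
    then show ?case by (simp add: deriv_free_linear)
  next
    case (Cons x xs)
    have gen: "plain_deriv \<delta> (sign_op l (gen x)) = sign_op l (\<delta> x)"
      using assms(1)[of "gen x"] by (simp add: deriv_free_gen)
    show ?case
      unfolding mon_Cons[of x xs] deriv_free_mult deriv_free_gen deriv_free_add Cons.IH sign_op_trivial
        gen assms sign_op_mult sign_op_linear(1)
      by (simp add: algebra_simps)
  qed
qed (simp_all add: deriv_free_linear distrib_left)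

lemma deriv_free_0: "deriv_free l r (\<lambda>_. 0) p = 0"
proof (rule free_eqI[where F = "deriv_free l r (\<lambda>_. 0)" and G = "\<lambda>_. 0"])
  fix xs :: "'a gen list"
  show "deriv_free l r (\<lambda>_. 0) (mon xs) = 0"
    unfolding deriv_free_def lin_ext_mon by (induction xs) simp_all
qed (simp_all add: deriv_free_linear)

text \<open>Any twist preserving the ideal is allowed here; contraction needs this because it is
  twisted by \<open>parity\<close>.\<close>

lemma deriv_free_idealI:
  assumes "\<And>q. q \<in> relations \<Longrightarrow> deriv_free l r \<delta> q \<in> rel_ideal"
    and "\<And>q. q \<in> rel_ideal \<Longrightarrow> sign_op l q \<in> rel_ideal" "\<And>q. q \<in> rel_ideal \<Longrightarrow> sign_op r q \<in> rel_ideal"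
    and "p \<in> rel_ideal"
  shows "deriv_free l r \<delta> p \<in> rel_ideal"
  using assms(4)
proof induction
  case (rel q p s)
  then have "q \<in> rel_ideal" by (rule relations_in_ideal)
  then have "sign_op l p * sign_op l q * deriv_free l r \<delta> s \<in> rel_ideal"
    "sign_op l p * deriv_free l r \<delta> q * sign_op r s \<in> rel_ideal"
    "deriv_free l r \<delta> p * sign_op r q * sign_op r s \<in> rel_ideal"
    using assms(1)[OF rel] assms(2,3) by (simp_all add: rel_ideal_mult_left rel_ideal_mult_right)
  then show ?case unfolding deriv_free_mult sign_op_mult
    by (simp add: distrib_right rel_ideal.add)
qed (auto simp: deriv_free_linear intro: rel_ideal.intros)

section \<open>Lowering, contraction and Euler operators on the free algebra\<close>

text \<open>If the derivative indices are read as a monomial in commuting symbols, this is the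
  formal partial derivative in the symbol of \<open>n\<close>, whence the factor
  \<open>count m n\<close>. The weight \<open>comp_agh\<close> makes the commutator with total
  derivatives measure the antighost number.\<close>

fun lower_gen :: "'n \<Rightarrow> 'n gen \<Rightarrow> 'n free" where
  "lower_gen n (Dx \<nu>) = 0"
| "lower_gen n (Jet m \<Phi>) =
     scal (comp_agh \<Phi> * count m n) * gen (Jet (m - {#n#}) \<Phi>)"

definition lower_free :: "'n \<Rightarrow> 'n free \<Rightarrow> 'n free" where
  "lower_free n = plain_deriv (lower_gen n)"

definition contract_gen :: "'n \<Rightarrow> 'n gen \<Rightarrow> 'n free" where
  "contract_gen n x = (if x = Dx n then 1 else 0)"

text \<open>The left twist by total parity makes this an odd derivation, to match a
  \<open>dx\<close> that anticommutes with every odd generator.\<close>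

definition contract_free :: "'n \<Rightarrow> 'n free \<Rightarrow> 'n free" where
  "contract_free n = deriv_free parity (\<lambda>_. 0) (contract_gen n)"

definition euler_free :: "('n gen \<Rightarrow> nat) \<Rightarrow> 'n free \<Rightarrow> 'n free" where
  "euler_free f = plain_deriv (\<lambda>x. scal (f x) * gen x)"

lemma sign_op_parity: "sign_op parity p = sign_op form_deg (sign_op grassmann p)"
proof (rule free_eqI[where F = "sign_op parity"])
  fix xs :: "'a gen list"
  have "(\<Sum>x\<leftarrow>xs. parity x) = (\<Sum>x\<leftarrow>xs. grassmann x) + (\<Sum>x\<leftarrow>xs. form_deg x)"
    by (induction xs) (simp_all add: parity_def)
  then show "sign_op parity (mon xs) = sign_op form_deg (sign_op grassmann (mon xs))"
    by (simp add: sign_op_mon sign_op_sign power_add mult.assoc)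
qed (simp_all add: sign_op_linear sign_op_scalar)

lemma sign_op_parity_ideal: "p \<in> rel_ideal \<Longrightarrow> sign_op parity p \<in> rel_ideal"
  by (simp add: sign_op_parity sign_op_ideal)

text \<open>Index symmetries contain no \<open>dx\<close> and are annihilated; on supercommutators
  the twist by \<open>parity\<close> makes the terms cancel.\<close>

lemma contract_free_ideal:
  assumes "p \<in> rel_ideal"
  shows "contract_free n p \<in> rel_ideal"
  unfolding contract_free_def
proof (rule deriv_free_idealI[OF _ _ _ assms])
  fix q :: "'a free"
  assume "q \<in> relations"
  then show "deriv_free parity (\<lambda>_. 0) (contract_gen n) q \<in> rel_ideal"
  proof cases
    case (super_comm x y)
    then have "deriv_free parity (\<lambda>_. 0) (contract_gen n) q = 0"
      by (cases "x = Dx n"; cases "y = Dx n"; cases "even (parity x)"; cases "even (parity y)")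
        (simp_all add: deriv_free_mult deriv_free_linear sign_op_gen mult.assoc contract_gen_def sign_op_one
          parity_def)
    then show ?thesis by (simp add: rel_ideal.zero)
  qed (auto simp: deriv_free_linear contract_gen_def rel_ideal.zero)
qed (auto simp: sign_op_trivial sign_op_parity_ideal)

lemma scal_mult_ideal: "q \<in> relations \<Longrightarrow> scal c * q \<in> rel_ideal"
  by (intro rel_ideal_mult_left relations_in_ideal)

text \<open>All terms of an index symmetry share their derivative indices and antighost number, so
  lowering yields a multiple of the same symmetry. As it preserves parity, it sends a
  supercommutator to a combination of supercommutators.\<close>

lemma lower_free_ideal:
  assumes "p \<in> rel_ideal"
  shows "lower_free n p \<in> rel_ideal"
  unfolding lower_free_def
proof (rule deriv_free_idealI[OF _ _ _ assms])
  fix q :: "'a free"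
  assume "q \<in> relations"
  then show "plain_deriv (lower_gen n) q \<in> rel_ideal"
  proof cases
    case (super_comm x y)
    define s :: "'a free" where "s = (-1) ^ (parity x * parity y)"
    have par: "\<exists>c z'. lower_gen n z = scal c * gen z' \<and> parity z' = parity z" for z
    proof (cases z)
      case (Dx m)
      then show ?thesis by (auto intro!: exI[of _ 0] exI[of _ z])
    next
      case (Jet m \<Phi>)
      have "lower_gen n z = scal (comp_agh \<Phi> * count m n) * gen (Jet (m - {#n#}) \<Phi>)"
        "parity (Jet (m - {#n#}) \<Phi>) = parity z"
        unfolding Jet by (simp_all add: parity_def)
      then show ?thesis by blast
    qed
    obtain c x' where x': "lower_gen n x = scal c * gen x'" "parity x' = parity x"
      using par by blast
    obtain d y' where y': "lower_gen n y = scal d * gen y'" "parity y' = parity y"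
      using par by blast
    have "plain_deriv (lower_gen n) q =
        scal d * (gen x * gen y' - s * (gen y' * gen x))
      + scal c * (gen x' * gen y - s * (gen y * gen x'))"
      unfolding super_comm s_def[symmetric] mult.assoc deriv_free_diff
      unfolding s_def deriv_free_sign unfolding s_def[symmetric] deriv_free_mult
      by (simp add: sign_op_trivial deriv_free_gen x' y' algebra_simps scal_left_comm)
    also have "\<dots> \<in> rel_ideal"
      unfolding s_def using super_comm_ideal[of x y'] super_comm_ideal[of x' y]
      by (auto simp: x' y' intro!: rel_ideal.add rel_ideal_mult_left)
    finally show ?thesis .
  qed (auto simp: deriv_free_linear relations.intros simp flip: distrib_left right_diff_distrib
      intro!: rel_ideal.zero scal_mult_ideal)
qed (auto simp: sign_op_trivial)

lemma sign_op_lower_free: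
  assumes "s = form_deg \<or> s = grassmann"
  shows "sign_op s (lower_free n p) = lower_free n (sign_op s p)"
proof -
  have "sign_op s (lower_gen n x) = (-1) ^ (0 + s x) * lower_gen n x" for x
    using assms by (cases x; cases "even (grassmann x)")
      (auto simp: sign_op_linear sign_op_scal sign_op_gen parity_def mult.assoc)
  from sign_op_deriv_free[of s "lower_gen n" 0, OF this] show ?thesis
    by (simp add: lower_free_def)
qed

text \<open>Both composites vanish on generators: \<open>gamma_gen\<close> produces only ghosts,
  which have antighost number zero, and the generators that survive lowering are antifields, which
  \<gamma> kills.\<close>

lemma lower_gamma_free: "lower_free n (gamma_free p) = gamma_free (lower_free n p)"
proof -
  have "lower_free n (gamma_gen x) = gamma_free (lower_gen n x)" for x
    by (cases x rule: gamma_gen.cases)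
      (simp_all add: lower_free_def gamma_free_def deriv_free_linear)
  then show ?thesis
    unfolding gamma_free_def lower_free_def
    by (subst plain_deriv_commutator)
      (simp_all add: deriv_free_0 sign_op_lower_free[unfolded lower_free_def])
qed

lemma partial_contract_free: "partial_free n (contract_free m p) = contract_free m (partial_free n p)"
proof -
  have "partial_free n (contract_gen m x) = contract_free m (partial_gen n x)" for x
    by (cases x) (simp_all add: partial_free_def contract_free_def deriv_free_linear contract_gen_def)
  then show ?thesis
    unfolding contract_free_def partial_free_def
    by (subst plain_deriv_commutator)
      (simp_all add: deriv_free_0 sign_op_trivial sign_op_parity sign_op_partial_free[unfolded partial_free_def])
qed

lemma partial_partial_free: "partial_free n (partial_free m p) = partial_free m (partial_free n p)"
proof -
  have "partial_free n (partial_gen m x) = partial_free m (partial_gen n x)" for x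
    by (cases x) (simp_all add: partial_free_def deriv_free_linear add_mset_commute)
  then show ?thesis
    unfolding partial_free_def
    by (subst plain_deriv_commutator) (simp_all add: deriv_free_0 sign_op_trivial)
qed

lemma lower_lower_free: "lower_free n (lower_free m p) = lower_free m (lower_free n p)"
proof -
  have "lower_free n (lower_gen m x) = lower_free m (lower_gen n x)" for x
  proof (cases x)
    case (Jet M \<Phi>)
    \<comment> \<open>This is the symmetry of second partial derivatives.\<close>
    have "count M m * count (M - {#m#}) n = count M n * count (M - {#n#}) m" by auto
    then have "(comp_agh \<Phi> * count M m) * (comp_agh \<Phi> * count (M - {#m#}) n) =
      (comp_agh \<Phi> * count M n) * (comp_agh \<Phi> * count (M - {#n#}) m)" by (simp only: mult_ac)
    then have "scal ((comp_agh \<Phi> * count M m) * (comp_agh \<Phi> * count (M - {#m#}) n)) * gen (Jet (M - {#n, m#}) \<Phi>) =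
      scal ((comp_agh \<Phi> * count M n) * (comp_agh \<Phi> * count (M - {#n#}) m)) * gen (Jet (M - {#m, n#}) \<Phi>)"
      by (simp only: add_mset_commute)
    then show ?thesis
      by (simp add: Jet lower_free_def deriv_free_linear diff_right_commute scal_scal del: count_diff)
  qed (simp add: lower_free_def deriv_free_linear)
  then show ?thesis
    unfolding lower_free_def
    by (subst plain_deriv_commutator) (simp_all add: deriv_free_0 sign_op_trivial)
qed

text \<open>Inserting \<open>n\<close> raises its multiplicity by one, so on a generator the two
  orders differ by one unit of the weight \<open>agh\<close>. The derivation with these values is
  the Euler operator.\<close>

lemma lower_partial_free:
  "lower_free n (partial_free m p) = partial_free m (lower_free n p) + (if n = m then euler_free agh p else 0)"
proof -
  have "lower_free n (partial_gen m x) - partial_free m (lower_gen n x)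
      = (if n = m then scal (agh x) * gen x else 0)" for x
  proof (cases x)
    case (Jet M \<Phi>)
    show ?thesis
    proof (cases "n = m")
      case True
      \<comment> \<open>Adding \<open>n\<close> back to \<open>M - {#n#}\<close> restores
        \<open>M\<close> only if \<open>n\<close> occurs in \<open>M\<close>; otherwise the
        coefficient of that term is zero.\<close>
      have "n \<in># M \<or> count M n = 0" by (meson not_in_iff)
      then show ?thesis unfolding Jet True
        by (auto simp: lower_free_def partial_free_def deriv_free_linear distrib_left
          distrib_right True scal_add)
    next
      case False
      then show ?thesis unfolding Jet
        by (auto simp add: lower_free_def partial_free_def deriv_free_linear)
    qed
  qed (auto simp: lower_free_def partial_free_def deriv_free_linear)
  then show ?thesis
    unfolding lower_free_def partial_free_def euler_free_def
    by (subst plain_deriv_commutator) (auto simp: deriv_free_0 sign_op_trivial)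
qed

lemma sign_op_contract_grassmann: "sign_op grassmann (contract_free n p) = contract_free n (sign_op grassmann p)"
proof -
  have "sign_op grassmann (contract_gen n x) = (-1) ^ (0 + grassmann x) * contract_gen n x" for x
    by (simp add: contract_gen_def sign_op_one sign_op_linear)
  from sign_op_deriv_free[of grassmann "contract_gen n" 0, OF this] show ?thesis
    by (simp add: contract_free_def)
qed

text \<open>Both operators are twisted, so \<open>plain_deriv_commutator\<close> does not apply and
  the Leibniz rules are expanded on words.\<close>

lemma contract_gamma_free: "contract_free n (gamma_free p) = - gamma_free (contract_free n p)"
proof (rule free_eqI[where F = "\<lambda>p. contract_free n (gamma_free p)"])
  fix xs :: "'a gen list"
  show "contract_free n (gamma_free (mon xs)) = - gamma_free (contract_free n (mon xs))"
  proof (induction xs)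
    case Nil
    then show ?case by (simp add: contract_free_def gamma_free_linear deriv_free_linear)
  next
    case (Cons x xs)
    have mult: "contract_free n (p * q) = sign_op parity p * contract_free n q + contract_free n p * q"
      for p q :: "'a free"
      by (simp add: contract_free_def deriv_free_mult sign_op_trivial)
    have lin: "contract_free n (p + q) = contract_free n p + contract_free n q"
      "contract_free n ((-1) ^ k * p) = (-1) ^ k * contract_free n p"
      "contract_free n (gen x) = contract_gen n x" for p q x k
      by (simp_all add: contract_free_def deriv_free_linear)
    have "contract_free n (gamma_gen x) = 0"
      by (cases x rule: gamma_gen.cases)
        (simp_all add: contract_free_def deriv_free_linear contract_gen_def)
    moreover have "sign_op parity (gamma_gen x) = - ((-1) ^ grassmann x) * gamma_gen x"
      by (cases x rule: gamma_gen.cases)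
        (simp_all add: sign_op_linear sign_op_gen mult_2 parity_def)
    moreover have "sign_op form_deg (contract_gen n x) = contract_gen n x"
      "gamma_free (contract_gen n x) = 0"
      by (simp_all add: contract_gen_def sign_op_linear sign_op_one gamma_free_linear)
    moreover have "contract_free n (gamma_free (gen x * mon xs)) =
        (-1) ^ form_deg x * ((-1) ^ parity x * (gen x * contract_free n (gamma_free (mon xs)))
          + contract_gen n x * gamma_free (mon xs))
      + (sign_op parity (gamma_gen x) * contract_free n (sign_op grassmann (mon xs))
          + contract_free n (gamma_gen x) * sign_op grassmann (mon xs))"
      unfolding gamma_free_mult sign_op_gen gamma_free_linear(5) lin(1) mult.assoc
      unfolding lin(2) unfolding mult
      by (simp add: lin sign_op_gen mult.assoc)
    moreover have "gamma_free (contract_free n (gen x * mon xs)) =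
        (-1) ^ parity x * ((-1) ^ form_deg x * (gen x * gamma_free (contract_free n (mon xs)))
          + gamma_gen x * sign_op grassmann (contract_free n (mon xs)))
      + (sign_op form_deg (contract_gen n x) * gamma_free (mon xs)
          + gamma_free (contract_gen n x) * sign_op grassmann (mon xs))"
      unfolding mult sign_op_gen gamma_free_linear(1) mult.assoc
      unfolding gamma_free_linear(4) unfolding gamma_free_mult
      by (simp add: lin sign_op_gen mult.assoc gamma_free_linear)
    \<comment> \<open>For a \<open>dx\<close> the terms with \<open>gamma_gen\<close> vanish, for a
      jet variable those with \<open>contract_gen\<close>; what remains agrees up to an overall
      sign.\<close>
    ultimately show ?case
      unfolding mon_Cons[of x xs] sign_op_contract_grassmann
      by (cases x; cases "even (grassmann x)")
        (simp_all add: Cons.IH contract_gen_def parity_def)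
  qed
qed (simp_all add: gamma_free_linear contract_free_def deriv_free_linear)

section \<open>Operators on local forms\<close>

text \<open>Real scalars on the quotient make the operators linear maps and permit the final
  division by a nonzero scalar.\<close>

instantiation local_form :: (type) real_algebra_1
begin

lift_definition scaleR_local_form :: "real \<Rightarrow> 'a local_form \<Rightarrow> 'a local_form" is "\<lambda>c p. scal c * p"
  by (simp add: rel_ideal_mult_left flip: right_diff_distrib)

instance
proof
  fix a b :: "'a local_form" and c d :: real
  show "c *\<^sub>R (a + b) = c *\<^sub>R a + c *\<^sub>R b"
    by transfer (simp add: distrib_left rel_ideal.zero)
  show "(c + d) *\<^sub>R a = c *\<^sub>R a + d *\<^sub>R a"
    by transfer (simp add: scal_add distrib_right rel_ideal.zero)
  show "c *\<^sub>R d *\<^sub>R a = (c * d) *\<^sub>R a"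
    by transfer (simp add: scal_scal rel_ideal.zero)
  show "1 *\<^sub>R a = a"
    by transfer (simp add: scal_def rel_ideal.zero)
  show "c *\<^sub>R a * b = c *\<^sub>R (a * b)"
    by transfer (simp add: mult.assoc rel_ideal.zero)
  show "a * c *\<^sub>R b = c *\<^sub>R (a * b)"
    by transfer (simp add: scal_left_comm rel_ideal.zero)
qed

end

lift_definition lower :: "'n \<Rightarrow> 'n local_form \<Rightarrow> 'n local_form" is lower_free
  by (simp add: lower_free_def flip: deriv_free_diff)
    (simp add: lower_free_ideal flip: lower_free_def)

lift_definition contract :: "'n \<Rightarrow> 'n local_form \<Rightarrow> 'n local_form" is contract_free
  by (simp add: contract_free_def flip: deriv_free_diff)
    (simp add: contract_free_ideal flip: contract_free_def)

lemma linear_total_deriv: "linear (total_deriv m)"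
  by (intro linearI; transfer) (simp_all add: partial_free_def deriv_free_linear rel_ideal.zero)

lemma linear_lower: "linear (lower n)"
  by (intro linearI; transfer) (simp_all add: lower_free_def deriv_free_linear rel_ideal.zero)

lemma linear_contract: "linear (contract n)"
  by (intro linearI; transfer) (simp_all add: contract_free_def deriv_free_linear rel_ideal.zero)

lemma linear_gamma: "linear gamma"
  by (intro linearI; transfer) (simp_all add: gamma_free_def deriv_free_linear rel_ideal.zero)

lemmas total_deriv_linear = linear_total_deriv[THEN linear_add] linear_total_deriv[THEN linear_diff]
  linear_total_deriv[THEN linear_sum] linear_total_deriv[THEN linear_scale] linear_total_deriv[THEN linear_0]
lemmas lower_linear = linear_lower[THEN linear_add] linear_lower[THEN linear_diff]
  linear_lower[THEN linear_sum] linear_lower[THEN linear_scale] linear_lower[THEN linear_0]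
lemmas contract_linear = linear_contract[THEN linear_add] linear_contract[THEN linear_diff]
  linear_contract[THEN linear_sum] linear_contract[THEN linear_scale] linear_contract[THEN linear_0]
lemmas gamma_linear = linear_gamma[THEN linear_add] linear_gamma[THEN linear_diff]
  linear_gamma[THEN linear_sum] linear_gamma[THEN linear_scale] linear_gamma[THEN linear_0]

lemma linear_ext_d: "linear ext_d"
  by (intro linearI)
    (simp_all add: ext_d_def total_deriv_linear distrib_left sum.distrib scaleR_sum_right)

lemmas ext_d_linear = linear_ext_d[THEN linear_add] linear_ext_d[THEN linear_diff]
  linear_ext_d[THEN linear_sum] linear_ext_d[THEN linear_scale] linear_ext_d[THEN linear_0]

lemma total_deriv_commute: "total_deriv m (total_deriv n a) = total_deriv n (total_deriv m a)"
  by transfer (simp add: partial_partial_free rel_ideal.zero)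

lemma lower_commute: "lower m (lower n a) = lower n (lower m a)"
  by transfer (simp add: lower_lower_free rel_ideal.zero)

lemma lower_gamma: "lower n (gamma a) = gamma (lower n a)"
  by transfer (simp add: lower_gamma_free rel_ideal.zero)

lemma contract_total_deriv: "contract m (total_deriv n a) = total_deriv n (contract m a)"
  by transfer (simp add: partial_contract_free rel_ideal.zero)

lemma contract_gamma: "contract n (gamma a) = - gamma (contract n a)"
  by transfer (simp add: contract_gamma_free rel_ideal.zero)

lemma lower_mult: "lower n (a * b) = a * lower n b + lower n a * b"
  by transfer (simp add: lower_free_def deriv_free_mult sign_op_trivial rel_ideal.zero)

lemma total_deriv_dx_mult: "total_deriv n (dx m * a) = dx m * total_deriv n a"
  by transfer (simp add: partial_free_mult partial_free_linear rel_ideal.zero)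

lemma lower_dx_mult: "lower n (dx m * a) = dx m * lower n a"
  by transfer (simp add: lower_free_def deriv_free_mult sign_op_trivial deriv_free_gen rel_ideal.zero)

lemma contract_dx_mult: "contract n (dx m * a) = (if n = m then a else 0) - dx m * contract n a"
  by transfer (simp add: contract_free_def deriv_free_mult sign_op_trivial sign_op_gen deriv_free_gen
      contract_gen_def parity_def rel_ideal.zero)

section \<open>Monomials and operators that count degrees\<close>

lemma abs_exhaust: obtains p where "a = abs_local_form p"
  using local_form.abs_induct[of "\<lambda>a. \<exists>p. a = abs_local_form p"] by blast

definition monom :: "'n gen list \<Rightarrow> 'n local_form" where
  "monom xs = abs_local_form (mon xs)"

lemma monom_Nil: "monom [] = 1"
  by (simp add: monom_def one_local_form.abs_eq)

lemma monom_Cons: "monom (x # xs) = monom [x] * monom xs"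
  unfolding monom_def times_local_form.abs_eq by (simp flip: mon_Cons)

lemma dx_monom: "dx m = monom [Dx m]"
  by (simp add: monom_def dx_def)

definition hom :: "('n gen \<Rightarrow> int) \<Rightarrow> 'n free \<Rightarrow> int \<Rightarrow> bool" where
  "hom f p k \<longleftrightarrow> (\<forall>w\<in>Poly_Mapping.keys p. word_deg f w = k)"

lemma homogeneous_iff: "homogeneous f a k \<longleftrightarrow> (\<exists>p. a = abs_local_form p \<and> hom f p k)"
  by (simp add: homogeneous_def hom_def)

lemma free_eq_sum: "p = (\<Sum>w\<in>Poly_Mapping.keys p. scal (Poly_Mapping.lookup p w) * mon (letters w))"
proof -
  have "p = lin_ext mon p"
    by (rule free_eqI[where F = "\<lambda>p. p"]) (simp_all add: lin_ext_add lin_ext_scalar)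
  then show ?thesis by (simp add: lin_ext_def scal_def)
qed

text \<open>A homogeneous representative is a finite combination of words of the same degree, so
  additive statements reduce to monomials of that degree.\<close>

lemma homogeneous_induct [consumes 1, case_names zero monom add]:
  assumes "homogeneous f a k" and "P 0"
    and "\<And>xs c. (\<Sum>x\<leftarrow>xs. f x) = k \<Longrightarrow> P (c *\<^sub>R monom xs)"
    and "\<And>a b. P a \<Longrightarrow> P b \<Longrightarrow> P (a + b)"
  shows "P a"
proof -
  obtain p where p: "a = abs_local_form p" "hom f p k"
    using assms(1) by (auto simp: homogeneous_iff)
  have "P (abs_local_form (\<Sum>w\<in>A. scal (c w) * mon (letters w)))"
    if "finite A" "\<And>w. w \<in> A \<Longrightarrow> word_deg f w = k" for A c
    using that
  proof induction
    case (insert w A)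
    then show ?case using assms(3)[of "letters w" "c w"]
      by (auto simp: word_deg_def monom_def scaleR_local_form.abs_eq
          simp flip: plus_local_form.abs_eq intro!: assms(4))
  qed (use assms(2) in \<open>simp flip: zero_local_form.abs_eq\<close>)
  from this[of "Poly_Mapping.keys p" "Poly_Mapping.lookup p"] show ?thesis
    using p by (simp add: hom_def flip: free_eq_sum)
qed

lemma local_form_induct [case_names zero monom add]:
  assumes "P 0" "\<And>xs c. P (c *\<^sub>R monom xs)" "\<And>a b. P a \<Longrightarrow> P b \<Longrightarrow> P (a + b)"
  shows "P a"
proof -
  obtain p where p: "a = abs_local_form p" by (rule abs_exhaust)
  \<comment> \<open>For the zero grading every form is homogeneous of degree 0.\<close>
  have "homogeneous (\<lambda>_. 0) a 0"
    unfolding homogeneous_iff p by (auto simp: hom_def word_deg_def)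
  then show ?thesis using assms by (induction rule: homogeneous_induct) auto
qed

lemma euler_free_mon: "euler_free f (mon xs) = scal (\<Sum>x\<leftarrow>xs. f x) * mon xs"
proof (induction xs)
  case Nil
  then show ?case by (simp add: euler_free_def deriv_free_linear)
next
  case (Cons x xs)
  have "euler_free f (gen x * mon xs) = gen x * euler_free f (mon xs) + scal (f x) * gen x * mon xs"
    by (simp add: euler_free_def deriv_free_mult sign_op_trivial deriv_free_gen)
  then show ?case
    unfolding mon_Cons[of x xs] Cons.IH
    by (simp add: scal_left_comm[of "gen x"] scal_add distrib_right mult.assoc)
qed

text \<open>In antighost number \<open>k\<close> the Euler operator of
  \<open>lower_partial_free\<close> is multiplication by \<open>k\<close>.\<close>

lemma lower_total_deriv:
  assumes "has_agh a k"
  shows "lower n (total_deriv m a) = total_deriv m (lower n a) + (if n = m then of_int k *\<^sub>R a else 0)"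
  using assms unfolding has_agh_def
proof (induction rule: homogeneous_induct)
  case zero
  then show ?case by (simp add: lower_linear total_deriv_linear)
next
  case (add a b)
  then show ?case by (simp add: lower_linear total_deriv_linear scaleR_add_right)
next
  case (monom xs c)
  have "k = int (\<Sum>x\<leftarrow>xs. agh x)"
    using monom by (induction xs arbitrary: k) auto
  then have "lower n (total_deriv m (monom xs)) =
      total_deriv m (lower n (monom xs)) + (if n = m then of_int k *\<^sub>R monom xs else 0)"
    by (simp add: monom_def total_deriv.abs_eq lower.abs_eq lower_partial_free scaleR_local_form.abs_eq
        euler_free_mon flip: plus_local_form.abs_eq zero_local_form.abs_eq)
  then show ?case by (simp add: lower_linear total_deriv_linear scaleR_add_right)
qed

lemma abs_sign: "abs_local_form ((-1) ^ k * p) = (-1) ^ k * abs_local_form p"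
  by (cases "even k") (simp_all add: uminus_local_form.abs_eq)

text \<open>The sign from contracting past a generator cancels the sign from moving
  \<open>dx m\<close> past it, so each \<open>dx\<close> in the monomial contributes exactly one
  copy of it.\<close>

lemma dx_contract_monom:
  "(\<Sum>m\<in>UNIV. dx m * contract m (monom xs)) = of_nat (\<Sum>x\<leftarrow>xs. form_deg x) *\<^sub>R monom xs"
  for xs :: "'n::finite gen list"
proof (induction xs)
  case Nil
  have "contract m 1 = 0" for m :: 'n
    by transfer (simp add: contract_free_def deriv_free_one rel_ideal.zero)
  then show ?case by (simp add: monom_Nil)
next
  case (Cons x xs)
  have gen: "contract m (monom [x]) = (if x = Dx m then 1 else 0)" for m
    unfolding monom_def by (simp add: contract.abs_eq contract_free_def deriv_free_gen contract_gen_def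
        flip: one_local_form.abs_eq zero_local_form.abs_eq)
  have Leibniz: "contract m (monom [x] * monom xs) =
      (-1) ^ parity x * (monom [x] * contract m (monom xs)) + contract m (monom [x]) * monom xs" for m
    unfolding monom_def times_local_form.abs_eq contract.abs_eq abs_sign[symmetric] plus_local_form.abs_eq
    by (simp add: contract_free_def deriv_free_mult sign_op_trivial sign_op_gen mult.assoc)
  have swap: "dx m * monom [x] = (-1) ^ parity x * (monom [x] * dx m)" for m
    unfolding dx_monom monom_def times_local_form.abs_eq abs_sign[symmetric] local_form.abs_eq_iff
    using super_comm_ideal[of "Dx m" x] by (simp add: parity_def)
  have move: "dx m * (monom [x] * b) = (-1) ^ parity x * (monom [x] * (dx m * b))" for m b
    by (simp add: swap flip: mult.assoc)
  have "dx m * contract m (monom (x # xs)) =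
      monom [x] * (dx m * contract m (monom xs)) + (if x = Dx m then monom (x # xs) else 0)" for m
  proof -
    have "dx m * contract m (monom (x # xs)) =
        (-1) ^ parity x * (dx m * (monom [x] * contract m (monom xs)))
        + dx m * (contract m (monom [x]) * monom xs)"
      unfolding monom_Cons[of x xs] Leibniz by (cases "even (parity x)") (simp_all add: distrib_left right_diff_distrib)
    also have "\<dots> = monom [x] * (dx m * contract m (monom xs)) + (if x = Dx m then monom (x # xs) else 0)"
      unfolding move gen monom_Cons[of x xs]
      by (cases "even (parity x)"; cases "x = Dx m") (simp_all add: dx_monom)
    finally show ?thesis .
  qed
  then have "(\<Sum>m\<in>UNIV. dx m * contract m (monom (x # xs))) =
      monom [x] * (\<Sum>m\<in>UNIV. dx m * contract m (monom xs)) +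
      (\<Sum>m\<in>UNIV. if x = Dx m then monom (x # xs) else 0)"
    by (simp add: sum.distrib sum_distrib_left)
  then show ?case unfolding Cons.IH
    by (cases x) (simp_all add: monom_Cons[of _ xs] scaleR_add_left)
qed

lemma dx_contract:
  fixes a :: "'n::finite local_form"
  assumes "has_form_deg a p"
  shows "(\<Sum>m\<in>UNIV. dx m * contract m a) = of_int p *\<^sub>R a"
  using assms unfolding has_form_deg_def
proof (induction rule: homogeneous_induct)
  case (monom xs c)
  have "p = int (\<Sum>x\<leftarrow>xs. form_deg x)"
    using monom by (induction xs arbitrary: p) auto
  then show ?case
    using dx_contract_monom[of xs] by (simp add: contract_linear flip: scaleR_sum_right)
qed (simp_all add: contract_linear distrib_left sum.distrib scaleR_add_right)

section \<open>Local nilpotency of the lowering operators\<close>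

fun lower_nilpotent :: "nat \<Rightarrow> 'n local_form \<Rightarrow> bool" where
  "lower_nilpotent 0 a \<longleftrightarrow> a = 0"
| "lower_nilpotent (Suc l) a \<longleftrightarrow> (\<forall>n. lower_nilpotent l (lower n a))"

lemma lower_nilpotent_zero: "lower_nilpotent l 0"
  by (induction l) (simp_all add: lower_linear)

lemma lower_nilpotent_Suc: "lower_nilpotent l a \<Longrightarrow> lower_nilpotent (Suc l) a"
  by (induction l arbitrary: a) (simp_all add: lower_linear)

lemma lower_nilpotent_mono:
  assumes "lower_nilpotent l a" "l \<le> l'"
  shows "lower_nilpotent l' a"
proof -
  have "lower_nilpotent (l + i) a" for i
  proof (induction i)
    case (Suc i)
    then show ?case using lower_nilpotent_Suc by (metis add_Suc_right)
  qed (simp add: assms(1))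
  from this[of "l' - l"] show ?thesis using assms(2) by simp
qed

lemma lower_nilpotent_add: "lower_nilpotent l a \<Longrightarrow> lower_nilpotent l b \<Longrightarrow> lower_nilpotent l (a + b)"
  by (induction l arbitrary: a b) (simp_all add: lower_linear)

lemma lower_nilpotent_scaleR: "lower_nilpotent l a \<Longrightarrow> lower_nilpotent l (c *\<^sub>R a)"
  by (induction l arbitrary: a) (simp_all add: lower_linear)

text \<open>By the Leibniz rule, of \<open>i + j\<close> lowerings at least \<open>i\<close> hit the
  first factor or at least \<open>j\<close> the second. If \<open>i\<close> or \<open>j\<close> is
  0, a factor is already zero.\<close>

lemma lower_nilpotent_mult: "lower_nilpotent i a \<Longrightarrow> lower_nilpotent j b \<Longrightarrow> lower_nilpotent (i + j) (a * b)"
proof (induction "i + j" arbitrary: i j a b)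
  case (Suc l)
  show ?case
  proof (cases i; cases j)
    fix i' j' assume ij: "i = Suc i'" "j = Suc j'"
    have "lower_nilpotent l (a * lower n b + lower n a * b)" for n
      using Suc.hyps(1)[of i j' a "lower n b"] Suc.hyps(1)[of i' j "lower n a" b] Suc.hyps(2) Suc.prems ij
      by (intro lower_nilpotent_add) auto
    then show ?thesis by (simp add: lower_mult flip: Suc.hyps(2))
  qed (use Suc.prems in \<open>auto simp del: lower_nilpotent.simps(2) intro: lower_nilpotent_zero\<close>)
qed simp

text \<open>Each lowering removes one derivative index, and one more lowering kills a jet variable
  without indices; a \<open>dx\<close> is killed at once.\<close>

lemma lower_nilpotent_gen: "\<exists>l. lower_nilpotent l (monom [x])"
proof (cases x)
  case (Dx m)
  have "lower n (monom [x]) = 0" for n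
    unfolding Dx by (simp add: monom_def lower.abs_eq lower_free_def deriv_free_gen flip: zero_local_form.abs_eq)
  then have "lower_nilpotent 1 (monom [x])" by simp
  then show ?thesis ..
next
  case (Jet M \<Phi>)
  have "lower_nilpotent (Suc (size M)) (monom [Jet M \<Phi>])"
  proof (induction "size M" arbitrary: M)
    case 0
    then show ?case
      by (simp add: monom_def lower.abs_eq lower_free_def deriv_free_gen flip: zero_local_form.abs_eq)
  next
    case (Suc s)
    have "lower_nilpotent (Suc s) (lower n (monom [Jet M \<Phi>]))" for n
    proof (cases "n \<in># M")
      case True
      then have "s = size (M - {#n#})" using Suc.hyps(2) by (simp add: size_Diff_singleton)
      from Suc.hyps(1)[OF this] lower_nilpotent_scaleR
      have "lower_nilpotent (Suc s) (real (comp_agh \<Phi> * count M n) *\<^sub>R monom [Jet (M - {#n#}) \<Phi>])"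
        using \<open>s = _\<close> by metis
      then show ?thesis
        by (simp add: monom_def lower.abs_eq lower_free_def deriv_free_gen scaleR_local_form.abs_eq
            del: lower_nilpotent.simps)
    next
      case False
      then have "lower n (monom [Jet M \<Phi>]) = 0"
        by (simp add: monom_def lower.abs_eq lower_free_def deriv_free_gen not_in_iff flip: zero_local_form.abs_eq)
      then show ?thesis by (simp only: lower_nilpotent_zero)
    qed
    then show ?case using Suc.hyps(2) by (metis lower_nilpotent.simps(2))
  qed
  then show ?thesis unfolding Jet ..
qed

lemma lower_nilpotent_monom: "\<exists>l. lower_nilpotent l (monom xs)"
proof (induction xs)
  case Nil
  have "lower n 1 = 0" for n :: 'a
    by transfer (simp add: lower_free_def deriv_free_one rel_ideal.zero)
  then have "lower_nilpotent 1 (1 :: 'a local_form)" by simp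
  then show ?case unfolding monom_Nil ..
next
  case (Cons x xs)
  then show ?case
    unfolding monom_Cons[of x xs] using lower_nilpotent_gen[of x] lower_nilpotent_mult by blast
qed

text \<open>A local form is a finite combination of monomials, so the largest of their bounds
  serves.\<close>

lemma lower_nilpotent_ex: "\<exists>l. lower_nilpotent l a"
proof (induction a rule: local_form_induct)
  case zero
  show ?case using lower_nilpotent_zero by blast
next
  case (monom xs c)
  show ?case using lower_nilpotent_monom lower_nilpotent_scaleR by blast
next
  case (add a b)
  then obtain i j where "lower_nilpotent i a" "lower_nilpotent j b" by blast
  then have "lower_nilpotent (max i j) (a + b)"
    by (intro lower_nilpotent_add) (auto intro: lower_nilpotent_mono)
  then show ?case ..
qed

section \<open>Gradings\<close>

lemma word_deg_plus: "word_deg f (u + v) = word_deg f u + word_deg f v"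
  by (simp add: word_deg_def plus_word_def)

lemma hom_zero: "hom f 0 k"
  by (simp add: hom_def)

lemma hom_mon: "hom f (mon xs) (\<Sum>x\<leftarrow>xs. f x)"
  by (simp add: hom_def mon_def word_deg_def)

lemma hom_gen: "hom f (gen x) k \<longleftrightarrow> f x = k"
  by (auto simp: hom_def mon_def word_deg_def)

lemma hom_scal: "hom f (scal c) 0"
  by (simp add: hom_def scal_def word_deg_def zero_word_def)

lemma hom_add: "hom f p k \<Longrightarrow> hom f q k \<Longrightarrow> hom f (p + q) k"
  using Poly_Mapping.keys_add[of p q] by (auto simp: hom_def)

lemma hom_uminus: "hom f p k \<Longrightarrow> hom f (- p) k"
  by (simp add: hom_def in_keys_iff)

lemma hom_diff: "hom f p k \<Longrightarrow> hom f q k \<Longrightarrow> hom f (p - q) k"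
  using hom_add[of f p k "- q"] hom_uminus by fastforce

lemma hom_mult: "hom f p k \<Longrightarrow> hom f q l \<Longrightarrow> hom f (p * q) (k + l)"
  using keys_mult[of p q] by (fastforce simp: hom_def word_deg_plus)

lemma hom_sign: "hom f p k \<Longrightarrow> hom f ((-1) ^ n * p) k"
  by (cases "even n") (simp_all add: hom_uminus)

lemma hom_scal_mult: "hom f p k \<Longrightarrow> hom f (scal c * p) k"
  using hom_mult[OF hom_scal] by fastforce

lemma hom_sum: "(\<And>i. i \<in> A \<Longrightarrow> hom f (g i) k) \<Longrightarrow> hom f (sum g A) k"
  by (induction A rule: infinite_finite_induct) (auto intro: hom_zero hom_add)

lemma hom_lin_ext:
  assumes "hom f p k" "\<And>xs. (\<Sum>x\<leftarrow>xs. f x) = k \<Longrightarrow> hom h (g xs) j"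
  shows "hom h (lin_ext g p) j"
  unfolding lin_ext_def scal_def[symmetric] using assms
  by (auto simp: hom_def[of f] word_deg_def intro!: hom_sum hom_scal_mult)

lemma hom_deriv_word:
  assumes "\<And>x. hom f (\<delta> x) (f x + s)"
  shows "hom f (deriv_word l r \<delta> xs) ((\<Sum>x\<leftarrow>xs. f x) + s)"
proof (induction xs)
  case (Cons x xs)
  have "hom f (gen x * deriv_word l r \<delta> xs) (f x + ((\<Sum>x\<leftarrow>xs. f x) + s))"
    "hom f (\<delta> x * mon xs) (f x + s + (\<Sum>x\<leftarrow>xs. f x))"
    using hom_mon[of f "[x]"] by (auto intro!: hom_mult Cons.IH assms hom_mon)
  then show ?case
    by (auto simp: mult.assoc add_ac intro!: hom_add hom_sign)
qed (simp add: hom_zero)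

lemma hom_deriv_free:
  assumes "\<And>x. hom f (\<delta> x) (f x + s)" "hom f p k"
  shows "hom f (deriv_free l r \<delta> p) (k + s)"
  unfolding deriv_free_def using assms(2)
  by (rule hom_lin_ext) (use hom_deriv_word[of f \<delta> s] assms(1) in blast)

section \<open>Projection onto homogeneous components\<close>

definition grading :: "('n gen \<Rightarrow> int) \<Rightarrow> bool" where
  "grading f \<longleftrightarrow> (\<forall>q\<in>relations. \<exists>k. hom f q k)"

definition part_free :: "('n gen \<Rightarrow> int) \<Rightarrow> int \<Rightarrow> 'n free \<Rightarrow> 'n free" where
  "part_free f k = lin_ext (\<lambda>xs. if (\<Sum>x\<leftarrow>xs. f x) = k then mon xs else 0)"

lemma part_free_linear:
  "part_free f k (p + q) = part_free f k p + part_free f k q"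
  "part_free f k (p - q) = part_free f k p - part_free f k q"
  "part_free f k (scal c * p) = scal c * part_free f k p"
  "part_free f k 0 = 0"
  by (simp_all add: part_free_def lin_ext_add lin_ext_diff scal_def lin_ext_scalar)

lemma part_free_hom:
  assumes "hom f p j"
  shows "part_free f k p = (if j = k then p else 0)"
proof -
  have "part_free f k p = (\<Sum>w\<in>Poly_Mapping.keys p.
      scal (Poly_Mapping.lookup p w) * (if j = k then mon (letters w) else 0))"
    unfolding part_free_def lin_ext_def scal_def[symmetric]
    using assms by (intro sum.cong) (auto simp: hom_def word_deg_def)
  then show ?thesis using free_eq_sum[of p] by auto
qed

lemma hom_part_free: "hom f (part_free f k p) k"
  unfolding part_free_def lin_ext_def scal_def[symmetric]
  by (intro hom_sum) (auto intro!: hom_scal_mult hom_zero simp: hom_mon)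

text \<open>Projection only selects words and so respects any second grading; this lets projections
  for several gradings be applied in turn.\<close>

lemma part_free_preserves_hom:
  assumes "hom h p j"
  shows "hom h (part_free f k p) j"
  unfolding part_free_def using assms
  by (rule hom_lin_ext) (auto simp: hom_mon hom_zero)

text \<open>Splitting the outer factors into words writes \<open>p * q * r\<close> as a sum of
  homogeneous elements of the ideal, each of which is kept or discarded whole.\<close>

lemma part_free_ideal:
  assumes "grading f" "p \<in> rel_ideal"
  shows "part_free f k p \<in> rel_ideal"
  using assms(2)
proof induction
  case (rel q p r)
  obtain j where j: "hom f q j" using assms(1) rel by (auto simp: grading_def)
  show ?case
  proof (induction p rule: free_induct)
    case (single w c)
    show ?case
    proof (induction r rule: free_induct)
      case (single v d)
      have "hom f (Poly_Mapping.single u e) (word_deg f u)" for u e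
        by (simp add: hom_def)
      then have "hom f (Poly_Mapping.single w c * q * Poly_Mapping.single v d) (word_deg f w + j + word_deg f v)"
        by (intro hom_mult j)
      from part_free_hom[OF this] show ?case by (simp add: rel_ideal.zero rel_ideal.rel[OF rel])
    qed (simp_all add: distrib_left part_free_linear rel_ideal.zero rel_ideal.add)
  qed (simp_all add: distrib_right part_free_linear rel_ideal.zero rel_ideal.add)
qed (simp_all add: part_free_linear rel_ideal.zero rel_ideal.add)

lemma part_free_deriv_free:
  assumes "\<And>x. hom f (\<delta> x) (f x + s)"
  shows "part_free f (k + s) (deriv_free l r \<delta> p) = deriv_free l r \<delta> (part_free f k p)"
proof (rule free_eqI[where F = "\<lambda>p. part_free f (k + s) (deriv_free l r \<delta> p)"])
  fix xs :: "'a gen list"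
  have "hom f (deriv_free l r \<delta> (mon xs)) ((\<Sum>x\<leftarrow>xs. f x) + s)"
    by (intro hom_deriv_free assms hom_mon)
  from part_free_hom[OF this]
  show "part_free f (k + s) (deriv_free l r \<delta> (mon xs)) = deriv_free l r \<delta> (part_free f k (mon xs))"
    by (simp add: deriv_free_linear part_free_hom[OF hom_mon])
qed (simp_all add: part_free_linear deriv_free_linear flip: scal_def)

lemma part_free_gen_mult: "part_free f (k + f x) (gen x * p) = gen x * part_free f k p"
proof (rule free_eqI[where F = "\<lambda>p. part_free f (k + f x) (gen x * p)"])
  fix xs :: "'a gen list"
  have "hom f (gen x * mon xs) (f x + (\<Sum>x\<leftarrow>xs. f x))"
    using hom_mon[of f "x # xs"] by (simp add: mon_Cons[of x xs])
  from part_free_hom[OF this]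
  show "part_free f (k + f x) (gen x * mon xs) = gen x * part_free f k (mon xs)"
    by (simp add: add.commute part_free_hom[OF hom_mon])
qed (simp_all add: part_free_linear distrib_left scal_left_comm[of "gen x"] flip: scal_def)

text \<open>The choice of representative is immaterial for a \<open>grading\<close>, by
  \<open>degree_part_abs\<close>.\<close>

definition degree_part :: "('n gen \<Rightarrow> int) \<Rightarrow> int \<Rightarrow> 'n local_form \<Rightarrow> 'n local_form" where
  "degree_part f k a = abs_local_form (part_free f k (rep_local_form a))"

lemma degree_part_abs:
  assumes "grading f"
  shows "degree_part f k (abs_local_form p) = abs_local_form (part_free f k p)"
proof -
  have "rep_local_form (abs_local_form p) - p \<in> rel_ideal"
    unfolding local_form.abs_eq_iff[symmetric] by (rule Quotient3_abs_rep[OF Quotient3_local_form])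
  from part_free_ideal[OF assms this, of k] show ?thesis
    by (simp add: degree_part_def local_form.abs_eq_iff part_free_linear)
qed

lemma degree_part_add:
  assumes "grading f"
  shows "degree_part f k (a + b) = degree_part f k a + degree_part f k b"
  by (cases a rule: abs_exhaust; cases b rule: abs_exhaust)
    (simp add: degree_part_abs assms plus_local_form.abs_eq part_free_linear)

lemma degree_part_zero: "grading f \<Longrightarrow> degree_part f k 0 = 0"
  using degree_part_add[of f k 0 0] by simp

lemma degree_part_sum:
  assumes "grading f"
  shows "degree_part f k (sum g A) = (\<Sum>i\<in>A. degree_part f k (g i))"
  by (induction A rule: infinite_finite_induct) (simp_all add: degree_part_add degree_part_zero assms)

lemma degree_part_homogeneous:
  assumes "grading f" "homogeneous f a k"
  shows "degree_part f k a = a"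
proof -
  obtain p where "a = abs_local_form p" "hom f p k"
    using assms(2) by (auto simp: homogeneous_iff)
  then show ?thesis by (simp add: degree_part_abs assms(1) part_free_hom)
qed

lemma homogeneous_degree_part: "homogeneous f (degree_part f k a) k"
  unfolding degree_part_def homogeneous_iff using hom_part_free by blast

lemma homogeneous_degree_part_other:
  assumes "grading f" "homogeneous h a j"
  shows "homogeneous h (degree_part f k a) j"
  using assms part_free_preserves_hom
  by (fastforce simp: homogeneous_iff degree_part_abs)

lemma degree_part_total_deriv:
  assumes "grading f" "\<And>x. hom f (partial_gen m x) (f x)"
  shows "degree_part f k (total_deriv m a) = total_deriv m (degree_part f k a)"
  using part_free_deriv_free[of f "partial_gen m" 0] assms
  by (cases a rule: abs_exhaust)
    (simp add: degree_part_abs total_deriv.abs_eq partial_free_def)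

lemma degree_part_gamma:
  assumes "grading f" "\<And>x. hom f (gamma_gen x) (f x + s)"
  shows "degree_part f (k + s) (gamma a) = gamma (degree_part f k a)"
  using part_free_deriv_free[of f gamma_gen s] assms
  by (cases a rule: abs_exhaust)
    (simp add: degree_part_abs gamma.abs_eq gamma_free_def)

lemma degree_part_dx_mult:
  assumes "grading f"
  shows "degree_part f (k + f (Dx m)) (dx m * a) = dx m * degree_part f k a"
  by (cases a rule: abs_exhaust)
    (simp add: degree_part_abs assms dx_def times_local_form.abs_eq part_free_gen_mult)

lemma degree_part_ext_d:
  fixes a :: "'n::finite local_form"
  assumes "grading f" "\<And>m x. hom f (partial_gen m x) (f x)" "\<And>m. f (Dx m) = t"
  shows "degree_part f (k + t) (ext_d a) = ext_d (degree_part f k a)"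
proof -
  have "degree_part f (k + t) (dx m * total_deriv m a) = dx m * total_deriv m (degree_part f k a)" for m
    using degree_part_dx_mult[OF assms(1), of k m "total_deriv m a"] assms
    by (simp add: degree_part_total_deriv)
  then show ?thesis by (simp add: ext_d_def degree_part_sum assms(1))
qed

text \<open>\<open>ext_d\<close> raises the degree by \<open>t\<close> and \<open>gamma\<close> by
  \<open>s\<close>, so projecting the equation onto degree \<open>k\<close> keeps just these
  components of \<nu> and \<rho>.\<close>

lemma exact_decomposition_part:
  fixes \<nu> \<rho> :: "'n::finite local_form"
  assumes "grading f" "\<And>m x. hom f (partial_gen m x) (f x)" "\<And>m. f (Dx m) = t"
    and "\<And>x. hom f (gamma_gen x) (f x + s)"
    and "homogeneous f a k" "a = ext_d \<nu> + gamma \<rho>" "gamma \<nu> = 0"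
  shows "a = ext_d (degree_part f (k - t) \<nu>) + gamma (degree_part f (k - s) \<rho>)"
    and "gamma (degree_part f (k - t) \<nu>) = 0"
proof -
  have "a = degree_part f k a" using assms by (simp add: degree_part_homogeneous)
  also have "\<dots> = degree_part f (k - t + t) (ext_d \<nu>) + degree_part f (k - s + s) (gamma \<rho>)"
    using assms by (simp add: degree_part_add)
  finally show "a = ext_d (degree_part f (k - t) \<nu>) + gamma (degree_part f (k - s) \<rho>)"
    unfolding degree_part_ext_d[OF assms(1-3)] degree_part_gamma[OF assms(1,4)] .
  have "gamma (degree_part f (k - t) \<nu>) = degree_part f (k - t + s) (gamma \<nu>)"
    by (rule degree_part_gamma[OF assms(1,4), symmetric])
  then show "gamma (degree_part f (k - t) \<nu>) = 0"
    using assms by (simp add: degree_part_zero)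
qed

lemma gradings:
  assumes "f = (\<lambda>x. int (form_deg x)) \<or> f = (\<lambda>x. int (agh x)) \<or> f = gh"
  shows "grading f" "hom f (partial_gen m x) (f x)" "hom f (lower_gen m x) (f x)"
proof -
  show "grading f"
    unfolding grading_def
  proof
    fix q :: "'a free"
    assume "q \<in> relations"
    then show "\<exists>k. hom f q k"
    proof cases
      case (super_comm x y)
      have "hom f (gen x * gen y) (f x + f y)" "hom f (gen y * gen x) (f y + f x)"
        by (intro hom_mult; simp add: hom_gen)+
      then show ?thesis unfolding super_comm mult.assoc
        by (auto simp: add.commute intro!: exI[of _ "f x + f y"] hom_diff hom_sign)
    next
      case (riem_antisym1 \<Phi> m \<mu> \<nu> \<alpha> \<beta>)
      then show ?thesis using assms
        by (intro exI[of _ "f (Jet m (\<Phi> \<mu> \<nu> \<alpha> \<beta>))"]) (auto simp: hom_gen gh_def intro!: hom_add hom_diff)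
    next
      case (riem_antisym2 \<Phi> m \<mu> \<nu> \<alpha> \<beta>)
      then show ?thesis using assms
        by (intro exI[of _ "f (Jet m (\<Phi> \<mu> \<nu> \<alpha> \<beta>))"]) (auto simp: hom_gen gh_def intro!: hom_add hom_diff)
    next
      case (riem_pair \<Phi> m \<mu> \<nu> \<alpha> \<beta>)
      then show ?thesis using assms
        by (intro exI[of _ "f (Jet m (\<Phi> \<mu> \<nu> \<alpha> \<beta>))"]) (auto simp: hom_gen gh_def intro!: hom_add hom_diff)
    next
      case (riem_cyclic \<Phi> m \<mu> \<nu> \<alpha> \<beta>)
      then show ?thesis using assms
        by (intro exI[of _ "f (Jet m (\<Phi> \<mu> \<nu> \<alpha> \<beta>))"]) (auto simp: hom_gen gh_def intro!: hom_add hom_diff)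
    next
      case (hook_antisym \<Phi> m \<mu> \<nu> \<alpha>)
      then show ?thesis using assms
        by (intro exI[of _ "f (Jet m (\<Phi> \<mu> \<nu> \<alpha>))"]) (auto simp: hom_gen gh_def intro!: hom_add hom_diff)
    next
      case (hook_cyclic \<Phi> m \<mu> \<nu> \<alpha>)
      then show ?thesis using assms
        by (intro exI[of _ "f (Jet m (\<Phi> \<mu> \<nu> \<alpha>))"]) (auto simp: hom_gen gh_def intro!: hom_add hom_diff)
    next
      case (two_antisym \<Phi> m \<mu> \<nu>)
      then show ?thesis using assms
        by (intro exI[of _ "f (Jet m (\<Phi> \<mu> \<nu>))"]) (auto simp: hom_gen gh_def intro!: hom_add hom_diff)
    qed
  qed
  show "hom f (partial_gen m x) (f x)"
    using assms by (cases x) (auto simp: hom_gen hom_zero gh_def)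
  show "hom f (lower_gen m x) (f x)"
    using assms by (cases x) (auto simp: hom_gen hom_zero gh_def intro!: hom_scal_mult)
qed

lemma hom_two_mult: "hom f p k \<Longrightarrow> hom f (2 * p) k"
  by (simp add: mult_2 hom_add)

lemma hom_gamma_gen:
  "hom (\<lambda>x. int (form_deg x)) (gamma_gen x) (int (form_deg x) + 0)"
  "hom (\<lambda>x. int (agh x)) (gamma_gen x) (int (agh x) + 0)"
  "hom gh (gamma_gen x) (gh x + 1)"
  by (cases x rule: gamma_gen.cases;
      auto simp: hom_gen hom_zero gh_def intro!: hom_add hom_diff hom_two_mult)+

lemma homogeneous_lower:
  assumes "f = (\<lambda>x. int (form_deg x)) \<or> f = (\<lambda>x. int (agh x)) \<or> f = gh" "homogeneous f a k"
  shows "homogeneous f (lower n a) k"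
proof -
  obtain p where "a = abs_local_form p" "hom f p k"
    using assms(2) by (auto simp: homogeneous_iff)
  then show ?thesis
    using hom_deriv_free[of f "lower_gen n" 0] gradings(3)[OF assms(1)]
    by (auto simp: homogeneous_iff lower.abs_eq lower_free_def)
qed

lemma homogeneous_total_deriv:
  assumes "f = (\<lambda>x. int (form_deg x)) \<or> f = (\<lambda>x. int (agh x)) \<or> f = gh" "homogeneous f a k"
  shows "homogeneous f (total_deriv n a) k"
proof -
  obtain p where "a = abs_local_form p" "hom f p k"
    using assms(2) by (auto simp: homogeneous_iff)
  then show ?thesis
    using hom_deriv_free[of f "partial_gen n" 0] gradings(2)[OF assms(1)]
    by (auto simp: homogeneous_iff total_deriv.abs_eq partial_free_def)
qed

lemma homogeneous_add: "homogeneous f a k \<Longrightarrow> homogeneous f b k \<Longrightarrow> homogeneous f (a + b) k"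
  unfolding homogeneous_iff by (metis hom_add plus_local_form.abs_eq)

lemma homogeneous_scaleR: "homogeneous f a k \<Longrightarrow> homogeneous f (c *\<^sub>R a) k"
  unfolding homogeneous_iff by (metis hom_scal_mult scaleR_local_form.abs_eq)

lemma homogeneous_zero: "homogeneous f 0 k"
  unfolding homogeneous_iff by (metis hom_zero zero_local_form.abs_eq)

lemma homogeneous_diff: "homogeneous f a k \<Longrightarrow> homogeneous f b k \<Longrightarrow> homogeneous f (a - b) k"
  using homogeneous_add[of f a k "- b"] homogeneous_scaleR[of f b k "-1"] by simp

lemma homogeneous_sum: "(\<And>i. i \<in> A \<Longrightarrow> homogeneous f (g i) k) \<Longrightarrow> homogeneous f (sum g A) k"
  by (induction A rule: infinite_finite_induct) (auto intro: homogeneous_zero homogeneous_add)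

section \<open>The homotopy\<close>

text \<open>This is P of the opening explanation, the number operator of the Heisenberg algebra
  spanned by \<open>total_deriv\<close> and \<open>lower\<close>; \<open>homotopy_op\<close> is
  b.\<close>

definition number_op :: "'n::finite local_form \<Rightarrow> 'n local_form" where
  "number_op a = (\<Sum>n\<in>UNIV. total_deriv n (lower n a))"

definition homotopy_op :: "'n::finite local_form \<Rightarrow> 'n local_form" where
  "homotopy_op a = (\<Sum>n\<in>UNIV. contract n (lower n a))"

lemma linear_number_op: "linear number_op"
  by (intro linearI) (simp_all add: number_op_def lower_linear total_deriv_linear sum.distrib scaleR_sum_right)

lemmas number_op_linear = linear_number_op[THEN linear_add] linear_number_op[THEN linear_diff] linear_number_op[THEN linear_scale]
  linear_number_op[THEN linear_0]

lemma homogeneous_number_op: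
  assumes "f = (\<lambda>x. int (form_deg x)) \<or> f = (\<lambda>x. int (agh x)) \<or> f = gh" "homogeneous f a k"
  shows "homogeneous f (number_op a) k"
  unfolding number_op_def by (intro homogeneous_sum homogeneous_total_deriv homogeneous_lower assms)

lemma number_op_gamma: "number_op (gamma a) = gamma (number_op a)"
  by (simp add: number_op_def lower_gamma gamma_total_deriv gamma_linear)

lemma homotopy_op_gamma: "homotopy_op (gamma a) = - gamma (homotopy_op a)"
  by (simp add: homotopy_op_def lower_gamma contract_gamma gamma_linear sum_negf)

lemma ext_d_total_deriv: "ext_d (total_deriv n a) = total_deriv n (ext_d a)"
  by (simp add: ext_d_def total_deriv_linear total_deriv_dx_mult total_deriv_commute)

lemma lower_ext_d:
  assumes "has_agh a k"
  shows "lower n (ext_d a) = ext_d (lower n a) + of_int k *\<^sub>R (dx n * a)"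
proof -
  have "lower n (ext_d a) = (\<Sum>m\<in>UNIV. dx m * total_deriv m (lower n a)
      + (if n = m then of_int k *\<^sub>R (dx m * a) else 0))"
    unfolding ext_d_def lower_linear
    by (intro sum.cong) (auto simp: lower_dx_mult lower_total_deriv[OF assms] distrib_left)
  then show ?thesis by (simp add: ext_d_def sum.distrib)
qed

text \<open>\<open>ext_d\<close> adds one derivative and acts as a raising operator, shifting
  \<open>number_op\<close> by \<open>k\<close>.\<close>

lemma number_op_ext_d:
  assumes "has_agh a k"
  shows "ext_d (number_op a) = number_op (ext_d a) - of_int k *\<^sub>R ext_d a"
proof -
  have "ext_d (number_op a) = (\<Sum>n\<in>UNIV. total_deriv n (ext_d (lower n a)))"
    by (simp add: number_op_def ext_d_linear ext_d_total_deriv)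
  also have "\<dots> = (\<Sum>n\<in>UNIV. total_deriv n (lower n (ext_d a)) - of_int k *\<^sub>R (dx n * total_deriv n a))"
    by (simp add: lower_ext_d[OF assms] total_deriv_linear total_deriv_dx_mult)
  also have "\<dots> = number_op (ext_d a) - of_int k *\<^sub>R ext_d a"
    unfolding number_op_def ext_d_def sum_subtractf scaleR_sum_right ..
  finally show ?thesis .
qed

text \<open>Anticommuting \<open>contract n\<close> with \<open>ext_d\<close> gives
  \<open>total_deriv n\<close>, which assembles \<open>number_op\<close>; commuting
  \<open>lower n\<close> with \<open>ext_d\<close> gives \<open>k\<close> times \<open>dx n\<close>,
  which assembles the scalar term.\<close>

lemma homotopy:
  fixes a :: "'n::finite local_form"
  assumes "has_agh a k" "has_form_deg a p"
  shows "ext_d (homotopy_op a) + homotopy_op (ext_d a) = number_op a + (of_int k * (real CARD('n) - of_int p)) *\<^sub>R a"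
proof -
  have "homotopy_op (ext_d a) = (\<Sum>n\<in>UNIV. contract n (ext_d (lower n a)) + of_int k *\<^sub>R contract n (dx n * a))"
    by (simp add: homotopy_op_def lower_ext_d[OF assms(1)] contract_linear)
  also have "\<dots> = (\<Sum>n\<in>UNIV. contract n (ext_d (lower n a))) + of_int k *\<^sub>R (\<Sum>n\<in>UNIV. a - dx n * contract n a)"
    by (simp add: sum.distrib contract_dx_mult scaleR_sum_right)
  \<comment> \<open>The first summand occurs once per space-time index and gives the dimension; the
    second counts the \<open>dx\<close> factors and gives \<open>p\<close>.\<close>
  also have "(\<Sum>n\<in>UNIV. a - dx n * contract n a) = (real CARD('n) - of_int p) *\<^sub>R a"
    by (simp add: sum_subtractf dx_contract[OF assms(2)] scaleR_left_diff_distrib)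
      (simp add: scaleR_conv_of_real)
  also have "(\<Sum>n\<in>UNIV. contract n (ext_d (lower n a))) = number_op a - ext_d (homotopy_op a)"
  proof -
    have "contract n (ext_d (lower n a)) = total_deriv n (lower n a) - ext_d (contract n (lower n a))" for n
    proof -
      have "contract n (ext_d b) = (\<Sum>m\<in>UNIV. (if n = m then total_deriv m b else 0)
          - dx m * total_deriv m (contract n b))" for b :: "'n local_form"
        unfolding ext_d_def contract_linear
        by (intro sum.cong) (auto simp: contract_dx_mult contract_total_deriv)
      then show ?thesis by (simp add: sum_subtractf ext_d_def)
    qed
    then show ?thesis by (simp add: sum_subtractf number_op_def homotopy_op_def ext_d_linear)
  qed
  finally show ?thesis by simp
qed

text \<open>The product of the factors \<open>P - j k\<close> for \<open>s \<le> j < s + l\<close>.\<close>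

fun number_op_prod :: "real \<Rightarrow> nat \<Rightarrow> nat \<Rightarrow> 'n::finite local_form \<Rightarrow> 'n local_form" where
  "number_op_prod k s 0 a = a"
| "number_op_prod k s (Suc l) a = number_op_prod k (Suc s) l (number_op a - (s * k) *\<^sub>R a)"

lemma number_op_commute_prod: "number_op (number_op_prod k s l a) = number_op_prod k s l (number_op a)"
  by (induction l arbitrary: s a) (simp_all add: number_op_linear)

lemma lower_number_op:
  assumes "has_agh a k"
  shows "lower n (number_op a) = number_op (lower n a) + of_int k *\<^sub>R lower n a"
proof -
  have "has_agh (lower m a) k" for m
    using assms unfolding has_agh_def by (intro homogeneous_lower) simp_all
  then have "lower n (number_op a) = (\<Sum>m\<in>UNIV. total_deriv m (lower n (lower m a))
      + (if n = m then of_int k *\<^sub>R lower m a else 0))"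
    unfolding number_op_def lower_linear by (intro sum.cong) (simp_all add: lower_total_deriv)
  then show ?thesis
    by (simp add: sum.distrib number_op_def lower_commute[of n])
qed

text \<open>By \<open>lower_number_op\<close>, passing a lowering operator through the factor with
  \<open>j + 1\<close> turns it into the factor with \<open>j\<close>, so the offset drops by
  one.\<close>

lemma lower_number_op_prod:
  assumes "has_agh a k"
  shows "lower n (number_op_prod (of_int k) (Suc s) l a) = number_op_prod (of_int k) s l (lower n a)"
  using assms
proof (induction l arbitrary: s a)
  case (Suc l)
  let ?b = "number_op a - (Suc s * real_of_int k) *\<^sub>R a"
  have "has_agh ?b k"
    using Suc.prems unfolding has_agh_def
    by (intro homogeneous_diff homogeneous_number_op homogeneous_scaleR) simp_all
  moreover have "lower n ?b = number_op (lower n a) - (s * real_of_int k) *\<^sub>R lower n a"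
    by (simp add: lower_linear lower_number_op[OF Suc.prems] distrib_right scaleR_add_left)
  ultimately show ?case using Suc.IH[of ?b "Suc s"] by simp
qed simp

text \<open>The factor with \<open>j = 0\<close> is \<open>number_op\<close> itself. Applied last,
  its lowering operators carry the other factors to the product for \<open>lower n a\<close>, which
  vanishes by induction.\<close>

lemma number_op_prod_nilpotent:
  assumes "has_agh a k" "lower_nilpotent l a"
  shows "number_op_prod (of_int k) 0 l a = 0"
  using assms
proof (induction l arbitrary: a)
  case (Suc l)
  have "has_agh (lower n a) k" for n
    using Suc.prems unfolding has_agh_def by (intro homogeneous_lower) simp_all
  then have "lower n (number_op_prod (of_int k) (Suc 0) l a) = 0" for n
    using Suc by (simp add: lower_number_op_prod)
  then have "number_op (number_op_prod (of_int k) (Suc 0) l a) = 0"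
    by (simp add: number_op_def total_deriv_linear)
  then show ?case by (simp add: number_op_commute_prod)
qed simp

section \<open>Triviality of cocycles\<close>

text \<open>The degrees of \<nu> and \<rho> are left free; projection fixes them at the end.\<close>

definition trivial :: "'n::finite local_form \<Rightarrow> bool" where
  "trivial a \<longleftrightarrow> (\<exists>\<nu> \<rho>. a = ext_d \<nu> + gamma \<rho> \<and> gamma \<nu> = 0)"

lemma trivial_add:
  assumes "trivial a" "trivial b"
  shows "trivial (a + b)"
proof -
  obtain \<nu> \<rho> \<nu>' \<rho>' where "a = ext_d \<nu> + gamma \<rho>" "gamma \<nu> = 0" "b = ext_d \<nu>' + gamma \<rho>'" "gamma \<nu>' = 0"
    using assms by (auto simp: trivial_def)
  then have "a + b = ext_d (\<nu> + \<nu>') + gamma (\<rho> + \<rho>')" "gamma (\<nu> + \<nu>') = 0"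
    by (simp_all add: ext_d_linear gamma_linear)
  then show ?thesis unfolding trivial_def by blast
qed

lemma trivial_scaleR:
  assumes "trivial a"
  shows "trivial (c *\<^sub>R a)"
proof -
  obtain \<nu> \<rho> where "a = ext_d \<nu> + gamma \<rho>" "gamma \<nu> = 0"
    using assms by (auto simp: trivial_def)
  then have "c *\<^sub>R a = ext_d (c *\<^sub>R \<nu>) + gamma (c *\<^sub>R \<rho>)" "gamma (c *\<^sub>R \<nu>) = 0"
    by (simp_all add: ext_d_linear gamma_linear scaleR_add_right)
  then show ?thesis unfolding trivial_def by blast
qed

text \<open>Applying one factor gives a cocycle \<open>b\<close> with one factor fewer, trivial by
  induction. The homotopy makes \<open>number_op a + c *\<^sub>R a\<close> trivial, and subtracting
  \<open>b\<close> leaves a nonzero multiple of \<open>a\<close>.\<close>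

lemma cocycle_trivial:
  fixes a \<mu> :: "'n::finite local_form"
  assumes "k > 0" "p < int CARD('n)"
    and "has_agh a k" "has_form_deg a p" "gamma a = 0" "ext_d a = gamma \<mu>"
    and "number_op_prod (of_int k) s l a = 0"
  shows "trivial a"
  using assms(3-)
proof (induction l arbitrary: a \<mu> s)
  case 0
  \<comment> \<open>The empty product is the identity, so here \<open>a = 0\<close>.\<close>
  have "0 = ext_d 0 + gamma (0 :: 'n local_form)"
    by (simp add: ext_d_linear)
  then show ?case using 0 unfolding trivial_def by (metis gamma_zero number_op_prod.simps(1))
next
  case (Suc l)
  define b where "b = number_op a - (s * real_of_int k) *\<^sub>R a"
  define c where "c = of_int k * (real CARD('n) - of_int p)"
  have "has_agh b k" "has_form_deg b p"
    using Suc.prems unfolding has_agh_def has_form_deg_def b_def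
    by (intro homogeneous_diff homogeneous_number_op homogeneous_scaleR; simp)+
  moreover have "gamma b = 0"
    using Suc.prems by (simp add: b_def gamma_linear number_op_linear flip: number_op_gamma)
  \<comment> \<open>The middle term is the shift from \<open>number_op_ext_d\<close>.\<close>
  moreover have "ext_d b = gamma (number_op \<mu> - of_int k *\<^sub>R \<mu> - (s * real_of_int k) *\<^sub>R \<mu>)"
    using Suc.prems by (simp add: b_def ext_d_linear number_op_ext_d gamma_linear number_op_gamma)
  ultimately have b: "trivial b"
    using Suc.IH Suc.prems by (simp add: b_def)
  have "gamma (homotopy_op a) = 0"
    using homotopy_op_gamma[of a] Suc.prems by (simp add: homotopy_op_def contract_linear lower_linear)
  \<comment> \<open>Since \<open>ext_d a = gamma \<mu>\<close> and \<open>homotopy_op\<close>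
    anticommutes with \<open>gamma\<close>, the second half of the homotopy formula is
    \<gamma>-exact.\<close>
  moreover have "ext_d (homotopy_op a) + gamma (- homotopy_op \<mu>) = number_op a + c *\<^sub>R a"
    using homotopy[of a k p] Suc.prems by (simp add: c_def homotopy_op_gamma linear_neg[OF linear_gamma])
  ultimately have "trivial (number_op a + c *\<^sub>R a)"
    unfolding trivial_def by metis
  then have "trivial ((number_op a + c *\<^sub>R a) + (-1) *\<^sub>R b)"
    by (rule trivial_add) (rule trivial_scaleR[OF b])
  also have "(number_op a + c *\<^sub>R a) + (-1) *\<^sub>R b = (c + s * real_of_int k) *\<^sub>R a"
    by (simp add: b_def scaleR_add_left)
  finally have "trivial (inverse (c + s * real_of_int k) *\<^sub>R (c + s * real_of_int k) *\<^sub>R a)"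
    by (rule trivial_scaleR)
  \<comment> \<open>The bounds \<open>k > 0\<close> and \<open>p < int CARD('n)\<close> enter here;
    the offset adds a nonnegative amount, so the scalar never vanishes.\<close>
  moreover have "c > 0"
    using assms(1,2) by (simp add: c_def)
  then have "c + s * real_of_int k > 0"
    using assms(1) by (simp add: add_pos_nonneg)
  ultimately show ?case by simp
qed

theorem theorem3p2:
  fixes a \<mu> :: "'n::finite local_form" and p k g :: int
  assumes "CARD('n) \<ge> 5"
    and "k > 0" and "p < int CARD('n)"
    and "has_form_deg a p" and "has_agh a k" and "has_gh a g"
    and "gamma a = 0" and "ext_d a = gamma \<mu>"
  shows "\<exists>\<nu> \<rho>. a = ext_d \<nu> + gamma \<rho> \<and> gamma \<nu> = 0 \<and>
           has_agh \<nu> k \<and> has_agh \<rho> k \<and>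
           has_gh \<nu> g \<and> has_gh \<rho> (g - 1) \<and>
           has_form_deg \<nu> (p - 1) \<and> has_form_deg \<rho> p"
proof -
  let ?F = "\<lambda>x. int (form_deg x)" and ?A = "\<lambda>x. int (agh x)"
  obtain l where "lower_nilpotent l a" using lower_nilpotent_ex by blast
  then have "number_op_prod (of_int k) 0 l a = 0" using assms number_op_prod_nilpotent by blast
  then have "trivial a" using assms cocycle_trivial by blast
  then obtain \<nu> \<rho> where *: "a = ext_d \<nu> + gamma \<rho>" "gamma \<nu> = 0"
    unfolding trivial_def by blast
  note g = gradings[of ?F, simplified] gradings[of ?A, simplified] gradings[of gh, simplified]
  \<comment> \<open>The decomposition is projected onto form degree, antighost number and ghost
    number in turn. Here \<open>t\<close> and \<open>s\<close> are the degrees of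
    \<open>ext_d\<close> and \<open>gamma\<close>: \<open>ext_d\<close> raises only the form degree,
    \<open>gamma\<close> only the ghost number, each by one.\<close>
  note 1 = exact_decomposition_part[where f = ?F and t = 1 and s = 0 and k = p, OF g(1,2) _ hom_gamma_gen(1) _ *]
  define \<nu>1 \<rho>1 where "\<nu>1 = degree_part ?F (p - 1) \<nu>" and "\<rho>1 = degree_part ?F p \<rho>"
  have *: "a = ext_d \<nu>1 + gamma \<rho>1" "gamma \<nu>1 = 0"
    using 1 assms by (simp_all add: has_form_deg_def \<nu>1_def \<rho>1_def)
  note 2 = exact_decomposition_part[where f = ?A and t = 0 and s = 0 and k = k, OF g(4,5) _ hom_gamma_gen(2) _ *]
  define \<nu>2 \<rho>2 where "\<nu>2 = degree_part ?A k \<nu>1" and "\<rho>2 = degree_part ?A k \<rho>1"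
  have *: "a = ext_d \<nu>2 + gamma \<rho>2" "gamma \<nu>2 = 0"
    using 2 assms by (simp_all add: has_agh_def \<nu>2_def \<rho>2_def)
  note 3 = exact_decomposition_part[where f = gh and t = 0 and s = 1 and k = g, OF g(7,8) _ hom_gamma_gen(3) _ *]
  define \<nu>3 \<rho>3 where "\<nu>3 = degree_part gh g \<nu>2" and "\<rho>3 = degree_part gh (g - 1) \<rho>2"
  have "a = ext_d \<nu>3 + gamma \<rho>3" "gamma \<nu>3 = 0"
    using 3 assms by (simp_all add: has_gh_def gh_def \<nu>3_def \<rho>3_def)
  \<comment> \<open>Later projections preserve the degrees fixed by earlier ones.\<close>
  moreover have "has_agh \<nu>3 k" "has_agh \<rho>3 k" "has_gh \<nu>3 g" "has_gh \<rho>3 (g - 1)"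
    "has_form_deg \<nu>3 (p - 1)" "has_form_deg \<rho>3 p"
    unfolding has_agh_def has_gh_def has_form_deg_def \<nu>3_def \<rho>3_def \<nu>2_def \<rho>2_def \<nu>1_def \<rho>1_def
    by (intro homogeneous_degree_part homogeneous_degree_part_other g)+
  ultimately show ?thesis by blast
qed

end
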